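(* Let $T$ be an even dimensional (compact) torus. Then any invariant generalized Kähler structure on $T$ is a generalized Calabi-Yau metric structure.
   Context: For a manifold $M$ with closed $\gamma\in\Omega^3(M)$, $\mathbb TM=TM\oplus T^*M$ carries the pairing $\langle X+\xi,Y+\eta\rangle=\frac12(\iota_X\eta+\iota_Y\xi)$ and the Dorfman bracket $(X+\xi)*(Y+\eta)=[X,Y]+\mathcal L_X\eta-\iota_Yd\xi+\iota_X\iota_Y\gamma$; it acts on forms by $(X+\xi)\cdot\varphi=\iota_X\varphi+\xi\wedge\varphi$. A generalized complex structure is an orthogonal $\mathbb J:\mathbb TM\to\mathbb TM$ with $\mathbb J^2=-1$ whose $i$-eigenbundle $L\subset\mathbb TM\otimes\mathbb C$ is closed under $*$. A generalized Kähler structure $(M,\gamma;\mathbb J_\pm,g)$ is a pair of commuting generalized complex structures with $-\mathbb J_+\mathbb J_-=\begin{pmatrix}0&g^{-1}\\ g&0\end{pmatrix}$, $g$ a Riemannian metric. Invariant generalized Kähler structures on $T$: let $\mathfrak t$ be the Lie algebra of $T$, $\sigma$ the invariant metric on $T$ given by an inner product on $\mathfrak t$, and $J_+,J_-$ two complex structures on the vector space $\mathfrak t$, orthogonal for this inner product. Let $I_\pm$ be the corresponding invariant complex structures on $T$ and $\omega_\pm=\sigma\circ I_\pm$. With $\gamma=0$ (the Cartan 3-form of an abelian group), the generalized Kähler structure $(T,0;\mathbb J_\pm,\sigma)$ is determined by, for $a,a'\in\mathfrak t$ with associated invariant vector fields $X_a,X_{a'}$, $$\mathbb J_\pm\big(X_{a'}-X_a+\sigma(X_{a'}+X_a)\big)=I_+X_{a'}\mp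 I_-X_a+\sigma(I_+X_{a'}\pm I_-X_a).$$ Generalized Calabi-Yau: a generalized complex structure $\mathbb J$ is generalized Calabi-Yau if its canonical line bundle $U\subset\wedge^*T^*M\otimes\mathbb C$ (the line bundle of pure spinors annihilated by $\bar L$) admits a nowhere vanishing section $\chi$ with $d_\gamma\chi=d\chi+\gamma\wedge\chi=0$. A generalized Kähler structure is a generalized Calabi-Yau metric structure if both $\mathbb J_+$ and $\mathbb J_-$ are generalized Calabi-Yau, with nowhere vanishing $d_\gamma$-closed sections $\chi_\pm$ of their canonical bundles whose lengths agree up to a constant: $(\chi_+,\bar\chi_+)=c\,(\chi_-,\bar\chi_-)$ for a nonzero constant $c$, where $(\varphi,\psi)$ is the Mukai pairing, i.e. the top degree component of $\varphi^{\top}\wedge\psi$ with $\top$ the anti-automorphism of the exterior algebra reversing the order of products of 1-forms. *)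

theory Defs
  imports "HOL-Analysis.Analysis"
begin

section \<open>Tori\<close>

text \<open>
  A torus with Lie algebra \<open>'a\<close> is the quotient \<open>'a / \<Lambda>\<close> by a full lattice \<open>\<Lambda>\<close>, the kernel of
  the exponential map. Its points are the cosets of \<open>\<Lambda>\<close>, and \<open>torus_exp \<Lambda>\<close> is the exponential map.
\<close>

definition full_lattice :: "'a::euclidean_space set \<Rightarrow> bool" where
  "full_lattice \<Lambda> \<longleftrightarrow>
     (\<exists>B. independent B \<and> span B = UNIV \<and> \<Lambda> = {\<Sum>b\<in>B. of_int (k b) *\<^sub>R b |k :: 'a \<Rightarrow> int. True})"

definition torus_exp :: "'a::euclidean_space set \<Rightarrow> 'a \<Rightarrow> 'a set" where
  "torus_exp \<Lambda> x = (\<lambda>l. x + l) ` \<Lambda>"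

definition torus :: "'a::euclidean_space set \<Rightarrow> 'a set set" where
  "torus \<Lambda> = range (torus_exp \<Lambda>)"

text \<open>Translation of a point of the torus by the group element \<open>exp a\<close>.\<close>

definition translate :: "'a::euclidean_space \<Rightarrow> 'a set \<Rightarrow> 'a set" where
  "translate a p = (\<lambda>y. a + y) ` p"

text \<open>
  The covering \<open>torus_exp \<Lambda>\<close> is a local diffeomorphism, so a map on the torus is smooth iff its
  pullback along it is. On the finite-dimensional space \<open>'a\<close>, being \<open>k + 1\<close> times continuously
  differentiable means being differentiable with all directional derivatives of class \<open>k\<close>.
\<close>

primrec C_class :: "nat \<Rightarrow> ('a::euclidean_space \<Rightarrow> 'b::real_normed_vector) \<Rightarrow> bool" where
  "C_class 0 f \<longleftrightarrow> continuous_on UNIV f"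
| "C_class (Suc k) f \<longleftrightarrow>
     (\<forall>x. f differentiable (at x)) \<and> (\<forall>v. C_class k (\<lambda>x. frechet_derivative f (at x) v))"

definition smooth_on_torus ::
    "'a::euclidean_space set \<Rightarrow> ('a set \<Rightarrow> 'b::real_normed_vector) \<Rightarrow> bool" where
  "smooth_on_torus \<Lambda> f \<longleftrightarrow> (\<forall>k. C_class k (\<lambda>x. f (torus_exp \<Lambda> x)))"

text \<open>
  The invariant vector fields \<open>X\<^sub>a\<close>, for \<open>a :: 'a\<close>, trivialise the tangent bundle. Throughout, the
  tangent space at every point is identified with \<open>'a\<close> in this way, so that \<open>X\<^sub>a\<close> is the constant
  map \<open>a\<close>, and vector fields, covector fields, forms, etc. are maps out of the torus with values
  in the corresponding space over \<open>'a\<close>. The derivative of \<open>f\<close> along \<open>X\<^sub>a\<close> at \<open>p\<close> is the following.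
\<close>

definition inv_deriv :: "('a::euclidean_space set \<Rightarrow> 'b::real_normed_vector) \<Rightarrow> 'a set \<Rightarrow> 'a \<Rightarrow> 'b" where
  "inv_deriv f p a = frechet_derivative (\<lambda>u. f (translate u p)) (at 0) a"


section \<open>Exterior algebra\<close>

text \<open>
  An element of the exterior algebra of \<open>'a\<^sup>*\<close> (real, or tensored with the complex numbers) is a
  function on lists of vectors: its restriction to lists of length \<open>k\<close> is its component of
  degree \<open>k\<close>, an alternating \<open>k\<close>-linear map. Components of degree above \<open>DIM('a)\<close> vanish
  automatically.
\<close>

definition alt_form :: "('a::real_vector list \<Rightarrow> 'b::real_vector) \<Rightarrow> bool" where
  "alt_form \<phi> \<longleftrightarrow>
     (\<forall>us vs. linear (\<lambda>v. \<phi> (us @ v # vs))) \<and> (\<forall>vs. \<not> distinct vs \<longrightarrow> \<phi> vs = 0)"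

text \<open>
  \<open>(\<alpha> \<and> \<beta>)(v\<^sub>0, v\<^sub>1, \<dots>)\<close> is the sum over all shuffles, i.e. all sets \<open>A\<close> of positions whose
  entries are passed to \<open>\<alpha>\<close>; the sign of the shuffle counts pairs out of order.
\<close>

definition wedge :: "('a list \<Rightarrow> 'b::comm_ring_1) \<Rightarrow> ('a list \<Rightarrow> 'b) \<Rightarrow> 'a list \<Rightarrow> 'b" where
  "wedge \<alpha> \<beta> vs =
     (\<Sum>A \<in> Pow {..<length vs}.
        (-1) ^ card {(i, j). i \<in> A \<and> j \<in> {..<length vs} - A \<and> j < i}
          * \<alpha> (nths vs A) * \<beta> (nths vs (- A)))"

definition one_form :: "('a::real_normed_vector \<Rightarrow>\<^sub>L real) \<Rightarrow> 'a list \<Rightarrow> real" where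
  "one_form \<xi> vs = (if length vs = 1 then blinfun_apply \<xi> (hd vs) else 0)"

text \<open>
  The value of \<open>\<alpha>\<^sub>k \<and> \<dots> \<and> \<alpha>\<^sub>1\<close> on \<open>(v\<^sub>1, \<dots>, v\<^sub>k)\<close> is that of \<open>\<alpha>\<^sub>1 \<and> \<dots> \<and> \<alpha>\<^sub>k\<close> on
  \<open>(v\<^sub>k, \<dots>, v\<^sub>1)\<close>, so the anti-automorphism reversing products of 1-forms reverses arguments.
\<close>

definition reversal :: "('a list \<Rightarrow> 'b) \<Rightarrow> 'a list \<Rightarrow> 'b" where
  "reversal \<phi> vs = \<phi> (rev vs)"

definition mukai :: "('a::euclidean_space list \<Rightarrow> complex) \<Rightarrow> ('a list \<Rightarrow> complex) \<Rightarrow> 'a list \<Rightarrow> complex" where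
  "mukai \<phi> \<psi> vs = (if length vs = DIM('a) then wedge (reversal \<phi>) \<psi> vs else 0)"

text \<open>
  Exterior derivative, evaluated on invariant vector fields; these commute, so the terms of the
  invariant formula that contain Lie brackets are absent.
\<close>

definition ext_deriv ::
    "('a::euclidean_space set \<Rightarrow> 'a list \<Rightarrow> 'b::real_normed_field) \<Rightarrow> 'a set \<Rightarrow> 'a list \<Rightarrow> 'b" where
  "ext_deriv \<phi> p vs =
     (\<Sum>i<length vs. (-1) ^ i * inv_deriv (\<lambda>q. \<phi> q (take i vs @ drop (Suc i) vs)) p (vs ! i))"

definition smooth_form ::
    "'a::euclidean_space set \<Rightarrow> ('a set \<Rightarrow> 'a list \<Rightarrow> 'b::real_normed_field) \<Rightarrow> bool" where
  "smooth_form \<Lambda> \<phi> \<longleftrightarrow>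
     (\<forall>p\<in>torus \<Lambda>. alt_form (\<phi> p)) \<and> (\<forall>vs. smooth_on_torus \<Lambda> (\<lambda>p. \<phi> p vs))"

definition closed_three_form ::
    "'a::euclidean_space set \<Rightarrow> ('a set \<Rightarrow> 'a list \<Rightarrow> real) \<Rightarrow> bool" where
  "closed_three_form \<Lambda> \<gamma> \<longleftrightarrow>
     smooth_form \<Lambda> \<gamma> \<and> (\<forall>p\<in>torus \<Lambda>. \<forall>vs. length vs \<noteq> 3 \<longrightarrow> \<gamma> p vs = 0) \<and>
     (\<forall>p\<in>torus \<Lambda>. \<forall>vs. ext_deriv \<gamma> p vs = 0)"

definition twisted_deriv ::
    "('a::euclidean_space set \<Rightarrow> 'a list \<Rightarrow> real) \<Rightarrow> ('a set \<Rightarrow> 'a list \<Rightarrow> complex)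
      \<Rightarrow> 'a set \<Rightarrow> 'a list \<Rightarrow> complex" where
  "twisted_deriv \<gamma> \<rho> p vs = ext_deriv \<rho> p vs + wedge (\<lambda>us. of_real (\<gamma> p us)) (\<rho> p) vs"


section \<open>Generalized geometry\<close>

text \<open>The fibre of \<open>TM \<oplus> T\<^sup>*M\<close>, and its complexification, where \<open>(u, v)\<close> stands for \<open>u + \<i> v\<close>.\<close>

type_synonym 'a gtan = "'a \<times> ('a \<Rightarrow>\<^sub>L real)"
type_synonym 'a cgtan = "'a gtan \<times> 'a gtan"

definition pairing :: "'a::real_normed_vector gtan \<Rightarrow> 'a gtan \<Rightarrow> real" where
  "pairing u v = (blinfun_apply (snd v) (fst u) + blinfun_apply (snd u) (fst v)) / 2"

definition lie_bracket ::
    "('a::euclidean_space set \<Rightarrow> 'a) \<Rightarrow> ('a set \<Rightarrow> 'a) \<Rightarrow> 'a set \<Rightarrow> 'a" where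
  "lie_bracket X Y p = inv_deriv Y p (X p) - inv_deriv X p (Y p)"

text \<open>Cartan's formula \<open>L\<^sub>X \<eta> = \<iota>\<^sub>X d\<eta> + d \<iota>\<^sub>X \<eta>\<close>.\<close>

definition lie_deriv ::
    "('a::euclidean_space set \<Rightarrow> 'a) \<Rightarrow> ('a set \<Rightarrow> 'a \<Rightarrow>\<^sub>L real) \<Rightarrow> 'a set \<Rightarrow> 'a \<Rightarrow> real" where
  "lie_deriv X \<eta> p z =
     ext_deriv (\<lambda>q. one_form (\<eta> q)) p [X p, z] + inv_deriv (\<lambda>q. blinfun_apply (\<eta> q) (X q)) p z"

definition dorfman ::
    "('a::euclidean_space set \<Rightarrow> 'a list \<Rightarrow> real) \<Rightarrow> ('a set \<Rightarrow> 'a gtan) \<Rightarrow> ('a set \<Rightarrow> 'a gtan)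
      \<Rightarrow> 'a set \<Rightarrow> 'a gtan" where
  "dorfman \<gamma> u v p =
     (let X = (\<lambda>q. fst (u q)); \<xi> = (\<lambda>q. snd (u q)); Y = (\<lambda>q. fst (v q)); \<eta> = (\<lambda>q. snd (v q)) in
       (lie_bracket X Y p,
        Blinfun (\<lambda>z. lie_deriv X \<eta> p z - ext_deriv (\<lambda>q. one_form (\<xi> q)) p [Y p, z]
                       + \<gamma> p [Y p, X p, z])))"

text \<open>Complex bilinear extension.\<close>

definition cdorfman ::
    "('a::euclidean_space set \<Rightarrow> 'a list \<Rightarrow> real) \<Rightarrow> ('a set \<Rightarrow> 'a cgtan) \<Rightarrow> ('a set \<Rightarrow> 'a cgtan)
      \<Rightarrow> 'a set \<Rightarrow> 'a cgtan" where
  "cdorfman \<gamma> s t p =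
     (let a = (\<lambda>q. fst (s q)); b = (\<lambda>q. snd (s q)); c = (\<lambda>q. fst (t q)); d = (\<lambda>q. snd (t q)) in
       (dorfman \<gamma> a c p - dorfman \<gamma> b d p, dorfman \<gamma> a d p + dorfman \<gamma> b c p))"

text \<open>The action on forms, and its complex linear extension.\<close>

definition spin_act ::
    "'a::real_normed_vector gtan \<Rightarrow> ('a list \<Rightarrow> complex) \<Rightarrow> 'a list \<Rightarrow> complex" where
  "spin_act u \<phi> vs = \<phi> (fst u # vs) + wedge (\<lambda>us. of_real (one_form (snd u) us)) \<phi> vs"

definition cspin_act ::
    "'a::real_normed_vector cgtan \<Rightarrow> ('a list \<Rightarrow> complex) \<Rightarrow> 'a list \<Rightarrow> complex" where
  "cspin_act w \<phi> vs = spin_act (fst w) \<phi> vs + \<i> * spin_act (snd w) \<phi> vs"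

text \<open>\<open>J (u + \<i> v) = \<i> (u + \<i> v)\<close>, and the conjugate bundle.\<close>

definition i_eigenspace :: "('a gtan \<Rightarrow> 'a::real_normed_vector gtan) \<Rightarrow> 'a cgtan set" where
  "i_eigenspace J = {(u, v). J u = - v \<and> J v = u}"

definition conj_eigenspace :: "('a gtan \<Rightarrow> 'a::real_normed_vector gtan) \<Rightarrow> 'a cgtan set" where
  "conj_eigenspace J = {(u, - v) |u v. (u, v) \<in> i_eigenspace J}"

definition generalized_complex ::
    "'a::euclidean_space set \<Rightarrow> ('a set \<Rightarrow> 'a list \<Rightarrow> real) \<Rightarrow> ('a set \<Rightarrow> 'a gtan \<Rightarrow> 'a gtan) \<Rightarrow> bool" where
  "generalized_complex \<Lambda> \<gamma> J \<longleftrightarrow>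
     (\<forall>u. smooth_on_torus \<Lambda> (\<lambda>p. J p u)) \<and>
     (\<forall>p\<in>torus \<Lambda>. linear (J p) \<and> (\<forall>u v. pairing (J p u) (J p v) = pairing u v) \<and>
        (\<forall>u. J p (J p u) = - u)) \<and>
     (\<forall>s t. smooth_on_torus \<Lambda> s \<and> smooth_on_torus \<Lambda> t \<and>
        (\<forall>p\<in>torus \<Lambda>. s p \<in> i_eigenspace (J p) \<and> t p \<in> i_eigenspace (J p)) \<longrightarrow>
        (\<forall>p\<in>torus \<Lambda>. cdorfman \<gamma> s t p \<in> i_eigenspace (J p)))"

text \<open>Inner products are given as maps \<open>'a \<rightarrow> 'a\<^sup>*\<close>.\<close>

definition inner_product :: "('a::real_normed_vector \<Rightarrow> 'a \<Rightarrow>\<^sub>L real) \<Rightarrow> bool" where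
  "inner_product g \<longleftrightarrow>
     linear g \<and> (\<forall>x y. blinfun_apply (g x) y = blinfun_apply (g y) x) \<and>
     (\<forall>x. x \<noteq> 0 \<longrightarrow> blinfun_apply (g x) x > 0)"

definition riemannian_metric ::
    "'a::euclidean_space set \<Rightarrow> ('a set \<Rightarrow> 'a \<Rightarrow> 'a \<Rightarrow>\<^sub>L real) \<Rightarrow> bool" where
  "riemannian_metric \<Lambda> g \<longleftrightarrow>
     (\<forall>p\<in>torus \<Lambda>. inner_product (g p)) \<and> (\<forall>x. smooth_on_torus \<Lambda> (\<lambda>p. g p x))"

definition generalized_kahler ::
    "'a::euclidean_space set \<Rightarrow> ('a set \<Rightarrow> 'a list \<Rightarrow> real) \<Rightarrow> ('a set \<Rightarrow> 'a gtan \<Rightarrow> 'a gtan)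
      \<Rightarrow> ('a set \<Rightarrow> 'a gtan \<Rightarrow> 'a gtan) \<Rightarrow> ('a set \<Rightarrow> 'a \<Rightarrow> 'a \<Rightarrow>\<^sub>L real) \<Rightarrow> bool" where
  "generalized_kahler \<Lambda> \<gamma> Jp Jm g \<longleftrightarrow>
     closed_three_form \<Lambda> \<gamma> \<and> generalized_complex \<Lambda> \<gamma> Jp \<and> generalized_complex \<Lambda> \<gamma> Jm \<and>
     riemannian_metric \<Lambda> g \<and>
     (\<forall>p\<in>torus \<Lambda>. \<forall>u. Jp p (Jm p u) = Jm p (Jp p u)) \<and>
     (\<forall>p\<in>torus \<Lambda>. \<forall>u. - Jp p (Jm p u) = (inv (g p) (snd u), g p (fst u)))"

text \<open>
  Translations preserve the trivialisation of the tangent bundle, so a field is translation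
  invariant iff its values at all translates of a point agree.
\<close>

definition translation_invariant :: "'a::euclidean_space set \<Rightarrow> ('a set \<Rightarrow> 'b) \<Rightarrow> bool" where
  "translation_invariant \<Lambda> F \<longleftrightarrow> (\<forall>p\<in>torus \<Lambda>. \<forall>a. F (translate a p) = F p)"

definition invariant_generalized_kahler ::
    "'a::euclidean_space set \<Rightarrow> ('a set \<Rightarrow> 'a list \<Rightarrow> real) \<Rightarrow> ('a set \<Rightarrow> 'a gtan \<Rightarrow> 'a gtan)
      \<Rightarrow> ('a set \<Rightarrow> 'a gtan \<Rightarrow> 'a gtan) \<Rightarrow> ('a set \<Rightarrow> 'a \<Rightarrow> 'a \<Rightarrow>\<^sub>L real) \<Rightarrow> bool" where
  "invariant_generalized_kahler \<Lambda> \<gamma> Jp Jm g \<longleftrightarrow>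
     generalized_kahler \<Lambda> \<gamma> Jp Jm g \<and>
     translation_invariant \<Lambda> \<gamma> \<and> translation_invariant \<Lambda> Jp \<and> translation_invariant \<Lambda> Jm \<and>
     translation_invariant \<Lambda> g"

text \<open>
  The fibre of the canonical line bundle. As \<open>conj_eigenspace J\<close> is maximal isotropic, its nonzero
  elements are pure spinors.
\<close>

definition canonical_fibre :: "('a gtan \<Rightarrow> 'a::real_normed_vector gtan) \<Rightarrow> ('a list \<Rightarrow> complex) set" where
  "canonical_fibre J = {\<phi>. alt_form \<phi> \<and> (\<forall>w\<in>conj_eigenspace J. \<forall>vs. cspin_act w \<phi> vs = 0)}"

definition calabi_yau_section ::
    "'a::euclidean_space set \<Rightarrow> ('a set \<Rightarrow> 'a list \<Rightarrow> real) \<Rightarrow> ('a set \<Rightarrow> 'a gtan \<Rightarrow> 'a gtan)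
      \<Rightarrow> ('a set \<Rightarrow> 'a list \<Rightarrow> complex) \<Rightarrow> bool" where
  "calabi_yau_section \<Lambda> \<gamma> J \<rho> \<longleftrightarrow>
     smooth_form \<Lambda> \<rho> \<and>
     (\<forall>p\<in>torus \<Lambda>. \<rho> p \<in> canonical_fibre (J p) \<and> (\<exists>vs. \<rho> p vs \<noteq> 0) \<and>
        (\<forall>vs. twisted_deriv \<gamma> \<rho> p vs = 0))"

definition generalized_calabi_yau ::
    "'a::euclidean_space set \<Rightarrow> ('a set \<Rightarrow> 'a list \<Rightarrow> real) \<Rightarrow> ('a set \<Rightarrow> 'a gtan \<Rightarrow> 'a gtan) \<Rightarrow> bool" where
  "generalized_calabi_yau \<Lambda> \<gamma> J \<longleftrightarrow>
     generalized_complex \<Lambda> \<gamma> J \<and> (\<exists>\<rho>. calabi_yau_section \<Lambda> \<gamma> J \<rho>)"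

definition generalized_calabi_yau_metric ::
    "'a::euclidean_space set \<Rightarrow> ('a set \<Rightarrow> 'a list \<Rightarrow> real) \<Rightarrow> ('a set \<Rightarrow> 'a gtan \<Rightarrow> 'a gtan)
      \<Rightarrow> ('a set \<Rightarrow> 'a gtan \<Rightarrow> 'a gtan) \<Rightarrow> ('a set \<Rightarrow> 'a \<Rightarrow> 'a \<Rightarrow>\<^sub>L real) \<Rightarrow> bool" where
  "generalized_calabi_yau_metric \<Lambda> \<gamma> Jp Jm g \<longleftrightarrow>
     generalized_kahler \<Lambda> \<gamma> Jp Jm g \<and>
     generalized_calabi_yau \<Lambda> \<gamma> Jp \<and> generalized_calabi_yau \<Lambda> \<gamma> Jm \<and>
     (\<exists>\<rho>p \<rho>m c. calabi_yau_section \<Lambda> \<gamma> Jp \<rho>p \<and> calabi_yau_section \<Lambda> \<gamma> Jm \<rho>m \<and> c \<noteq> 0 \<and>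
        (\<forall>p\<in>torus \<Lambda>. \<forall>vs.
           mukai (\<rho>p p) (\<lambda>us. cnj (\<rho>p p us)) vs = c * mukai (\<rho>m p) (\<lambda>us. cnj (\<rho>m p us)) vs))"


section \<open>The invariant structures determined by two complex structures on the Lie algebra\<close>

text \<open>
  For complex structures \<open>I\<^sub>\<plusminus>\<close> on \<open>'a\<close>, orthogonal for an inner product \<open>\<sigma>\<close>, the formula
  \<open>J\<^sub>\<plusminus> (a' - a + \<sigma> (a' + a)) = I\<^sub>+ a' \<minusplus> I\<^sub>- a + \<sigma> (I\<^sub>+ a' \<plusminus> I\<^sub>- a)\<close>
  defines an invariant generalized Kaehler structure with \<open>\<gamma> = 0\<close> and metric \<open>\<sigma>\<close>. This is
  \<open>invariant_generalized_kahler_of_complex_structures\<close>, proved at the end of this theory.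
\<close>

definition orthogonal_complex_structure ::
    "('a::real_normed_vector \<Rightarrow> 'a \<Rightarrow>\<^sub>L real) \<Rightarrow> ('a \<Rightarrow> 'a) \<Rightarrow> bool" where
  "orthogonal_complex_structure \<sigma> I \<longleftrightarrow>
     linear I \<and> (\<forall>x. I (I x) = - x) \<and>
     (\<forall>x y. blinfun_apply (\<sigma> (I x)) (I y) = blinfun_apply (\<sigma> x) y)"


lemma C_class_const: "C_class k (\<lambda>x. c)"
  by (induction k arbitrary: c) simp_all

lemma smooth_on_torus_const:
  assumes "\<And>p. p \<in> torus \<Lambda> \<Longrightarrow> f p = c"
  shows "smooth_on_torus \<Lambda> f"
  using assms by (simp add: smooth_on_torus_def torus_def C_class_const)

lemma translate_torus_exp: "translate a (torus_exp \<Lambda> x) = torus_exp \<Lambda> (a + x)"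
  by (auto simp: translate_def torus_exp_def image_image add.assoc)

lemma translate_in_torus: "p \<in> torus \<Lambda> \<Longrightarrow> translate a p \<in> torus \<Lambda>"
  by (auto simp: torus_def translate_torus_exp)

lemma translate_zero [simp]: "translate 0 p = p"
  by (simp add: translate_def)

lemma inv_deriv_has_derivative:
  assumes "smooth_on_torus \<Lambda> f" "p \<in> torus \<Lambda>"
  shows "((\<lambda>u. f (translate u p)) has_derivative inv_deriv f p) (at 0)"
proof -
  obtain x where x: "p = torus_exp \<Lambda> x" using assms(2) by (auto simp: torus_def)
  have "C_class 1 (\<lambda>x. f (torus_exp \<Lambda> x))" using assms(1) by (simp add: smooth_on_torus_def)
  then have "(\<lambda>x. f (torus_exp \<Lambda> x)) differentiable (at (0 + x))" by simp
  moreover have "(\<lambda>u. u + x) differentiable (at 0)" by simp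
  ultimately have "((\<lambda>x. f (torus_exp \<Lambda> x)) \<circ> (\<lambda>u. u + x)) differentiable (at 0)"
    by (intro differentiable_chain_at) simp_all
  then have "(\<lambda>u. f (translate u p)) differentiable (at 0)"
    by (simp add: x translate_torus_exp o_def)
  then have "((\<lambda>u. f (translate u p)) has_derivative
      frechet_derivative (\<lambda>u. f (translate u p)) (at 0)) (at 0)"
    using frechet_derivative_works by blast
  then show ?thesis unfolding inv_deriv_def[abs_def] .
qed

lemma inv_deriv_eqI:
  assumes "((\<lambda>u. f (translate u p)) has_derivative f') (at 0)"
  shows "inv_deriv f p a = f' a"
  unfolding inv_deriv_def using frechet_derivative_at[OF assms] by simp

lemma ext_deriv_one_form:
  fixes \<xi> :: "'a::euclidean_space set \<Rightarrow> 'a \<Rightarrow>\<^sub>L real"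
  assumes "((\<lambda>u. \<xi> (translate u p)) has_derivative D) (at 0)"
  shows "ext_deriv (\<lambda>q. one_form (\<xi> q)) p [x, z] = D x z - D z x"
proof -
  have *: "inv_deriv (\<lambda>q. blinfun_apply (\<xi> q) y) p a = D a y" for a y
    by (rule inv_deriv_eqI) (auto intro!: derivative_eq_intros assms simp: blinfun.bilinear_simps)
  show ?thesis
    by (simp add: ext_deriv_def numeral_2_eq_2 one_form_def *)
qed

lemma dorfman_zero:
  fixes u v :: "'a::euclidean_space set \<Rightarrow> 'a gtan"
  assumes u: "((\<lambda>a. u (translate a p)) has_derivative Du) (at 0)"
    and v: "((\<lambda>a. v (translate a p)) has_derivative Dv) (at 0)"
  shows "dorfman (\<lambda>_ _. 0) u v p =
    Dv (fst (u p)) - Du (fst (v p)) + (0, Blinfun (\<lambda>z. 2 * pairing (Du z) (v p)))"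
proof -
  have fu: "((\<lambda>a. fst (u (translate a p))) has_derivative (\<lambda>a. fst (Du a))) (at 0)"
    and su: "((\<lambda>a. snd (u (translate a p))) has_derivative (\<lambda>a. snd (Du a))) (at 0)"
    and fv: "((\<lambda>a. fst (v (translate a p))) has_derivative (\<lambda>a. fst (Dv a))) (at 0)"
    and sv: "((\<lambda>a. snd (v (translate a p))) has_derivative (\<lambda>a. snd (Dv a))) (at 0)"
    using has_derivative_fst[OF u] has_derivative_snd[OF u] has_derivative_fst[OF v]
      has_derivative_snd[OF v] by simp_all
  have bl: "bounded_linear Du" using u has_derivative_bounded_linear by blast
  have pr: "inv_deriv (\<lambda>q. blinfun_apply (snd (v q)) (fst (u q))) p z
      = snd (v p) (fst (Du z)) + snd (Dv z) (fst (u p))" for z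
    by (rule inv_deriv_eqI)
       (use blinfun.FDERIV[OF sv fu] in \<open>simp add: blinfun.bilinear_simps\<close>)
  have blp: "bounded_linear (\<lambda>z. 2 * pairing (Du z) (v p))"
    using bl unfolding linear_conv_bounded_linear[symmetric]
    by (simp add: linear_iff pairing_def blinfun.bilinear_simps field_simps)
  have "Blinfun (\<lambda>z. lie_deriv (\<lambda>q. fst (u q)) (\<lambda>q. snd (v q)) p z
          - ext_deriv (\<lambda>q. one_form (snd (u q))) p [fst (v p), z] + 0)
     = snd (Dv (fst (u p)) - Du (fst (v p))) + Blinfun (\<lambda>z. 2 * pairing (Du z) (v p))"
    (is "?l = ?r")
  proof -
    have "(\<lambda>z. lie_deriv (\<lambda>q. fst (u q)) (\<lambda>q. snd (v q)) p z
          - ext_deriv (\<lambda>q. one_form (snd (u q))) p [fst (v p), z] + 0) = blinfun_apply ?r"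
      by (rule ext, simp add: lie_deriv_def ext_deriv_one_form[OF su] ext_deriv_one_form[OF sv] pr
           blinfun.bilinear_simps bounded_linear_Blinfun_apply[OF blp], simp add: pairing_def)
    then show ?thesis by (simp add: blinfun_apply_inverse)
  qed
  moreover have "lie_bracket (\<lambda>q. fst (u q)) (\<lambda>q. fst (v q)) p
      = fst (Dv (fst (u p)) - Du (fst (v p)))"
    by (simp add: lie_bracket_def inv_deriv_eqI[OF fu] inv_deriv_eqI[OF fv])
  ultimately show ?thesis
    unfolding dorfman_def Let_def by (simp add: prod_eq_iff)
qed

lemma linear_gtan_bounded_linear:
  fixes J :: "'a::euclidean_space gtan \<Rightarrow> 'b::real_normed_vector"
  assumes "linear J"
  shows "bounded_linear J"
proof -
  have e: "\<xi> = (\<Sum>b\<in>Basis. blinfun_apply \<xi> b *\<^sub>R blinfun_inner_left b)" for \<xi> :: "'a \<Rightarrow>\<^sub>L real"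
    by (rule blinfun_euclidean_eqI)
       (simp add: blinfun.sum_left blinfun.scaleR_left inner_Basis if_distrib sum.delta cong: if_cong)
  have J0: "J (x, \<xi>) = J (x, 0) + (\<Sum>b\<in>Basis. blinfun_apply \<xi> b *\<^sub>R J (0, blinfun_inner_left b))" for x \<xi>
  proof -
    have "(x, \<xi>) = (x, 0) + (\<Sum>b\<in>Basis. blinfun_apply \<xi> b *\<^sub>R (0, blinfun_inner_left b))"
      by (subst e[of \<xi>]) (simp add: prod_eq_iff fst_sum snd_sum)
    then show ?thesis
      by (simp only: linear_add[OF assms] linear_sum[OF assms] linear_cmul[OF assms] o_def)
  qed
  have J: "J = (\<lambda>w. J (fst w, 0) +
      (\<Sum>b\<in>Basis. blinfun_apply (snd w) b *\<^sub>R J (0, blinfun_inner_left b)))"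
    by (rule ext, subst J0[symmetric]) simp
  have "bounded_linear (\<lambda>x. J (x, 0))"
    unfolding linear_conv_bounded_linear[symmetric]
    using linear_add[OF assms, of "(_, 0)" "(_, 0)"] linear_cmul[OF assms, of _ "(_, 0)"]
    by (simp add: linear_iff)
  then have 1: "bounded_linear (\<lambda>w :: 'a gtan. J (fst w, 0))"
    by (rule bounded_linear_compose[OF _ bounded_linear_fst])
  have 2: "bounded_linear (\<lambda>w :: 'a gtan. blinfun_apply (snd w) b *\<^sub>R c)"
    for b and c :: 'b
    by (rule bounded_linear_compose[OF bounded_linear_scaleR_left
          bounded_linear_compose[OF blinfun.bounded_linear_left bounded_linear_snd]])
  show ?thesis
    by (subst J) (intro bounded_linear_add bounded_linear_sum 1 2)
qed

lemma generalized_complex_invariant: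
  fixes J0 :: "'a::euclidean_space gtan \<Rightarrow> 'a gtan"
  assumes lin: "linear J0" and orth: "\<And>u v. pairing (J0 u) (J0 v) = pairing u v"
    and sq: "\<And>u. J0 (J0 u) = - u" and J: "\<And>p. p \<in> torus \<Lambda> \<Longrightarrow> J p = J0"
  shows "generalized_complex \<Lambda> (\<lambda>_ _. 0) J"
proof -
  have bl: "bounded_linear J0" using lin by (rule linear_gtan_bounded_linear)
  have "cdorfman (\<lambda>_ _. 0) s t p \<in> i_eigenspace J0"
    if s: "smooth_on_torus \<Lambda> s" and t: "smooth_on_torus \<Lambda> t"
      and sL: "\<And>q. q \<in> torus \<Lambda> \<Longrightarrow> s q \<in> i_eigenspace J0"
      and tL: "\<And>q. q \<in> torus \<Lambda> \<Longrightarrow> t q \<in> i_eigenspace J0" and p: "p \<in> torus \<Lambda>" for s t p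
  proof -
    define u where "u q = fst (s q)" for q
    define v where "v q = fst (t q)" for q
    have su: "snd (s q) = - J0 (u q)" and tv: "snd (t q) = - J0 (v q)" if "q \<in> torus \<Lambda>" for q
      using sL[OF that] tL[OF that] by (auto simp: u_def v_def i_eigenspace_def)
    define Du where "Du a = fst (inv_deriv s p a)" for a
    define Dv where "Dv a = fst (inv_deriv t p a)" for a
    have du: "((\<lambda>a. u (translate a p)) has_derivative Du) (at 0)"
      using has_derivative_fst[OF inv_deriv_has_derivative[OF s p]]
      by (simp add: u_def Du_def[abs_def])
    have dv: "((\<lambda>a. v (translate a p)) has_derivative Dv) (at 0)"
      using has_derivative_fst[OF inv_deriv_has_derivative[OF t p]]
      by (simp add: v_def Dv_def[abs_def])
    have du': "((\<lambda>a. snd (s (translate a p))) has_derivative (\<lambda>a. - J0 (Du a))) (at 0)"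
      using has_derivative_minus[OF bounded_linear.has_derivative[OF bl du]]
      by (simp add: su translate_in_torus[OF p])
    have dv': "((\<lambda>a. snd (t (translate a p))) has_derivative (\<lambda>a. - J0 (Dv a))) (at 0)"
      using has_derivative_minus[OF bounded_linear.has_derivative[OF bl dv]]
      by (simp add: tv translate_in_torus[OF p])
    note J0s = linear_add[OF lin] linear_diff[OF lin] linear_neg[OF lin] sq
    have pm: "pairing (- x) y = - pairing x y" "pairing x (- y) = - pairing x y"
      for x y :: "'a gtan"
      by (simp_all add: pairing_def blinfun.bilinear_simps field_simps)
    have skew: "pairing (J0 x) y = - pairing x (J0 y)" for x y
      using orth[of x "J0 y"] by (simp add: sq pm)
    let ?P = "\<lambda>w z. Blinfun (\<lambda>a. 2 * pairing (w a) z)"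
    have neg: "Blinfun (\<lambda>a. - f a) = - Blinfun f" if "bounded_linear f" for f :: "'a \<Rightarrow> real"
      by (rule blinfun_eqI)
        (simp add: bounded_linear_Blinfun_apply that bounded_linear_minus blinfun.minus_left)
    have lDu: "linear Du" and lDv: "linear Dv"
      using du dv has_derivative_linear by blast+
    have blP: "bounded_linear (\<lambda>a. 2 * pairing (Du a) z)" for z
      unfolding linear_conv_bounded_linear[symmetric]
      using lDu by (simp add: linear_iff pairing_def blinfun.bilinear_simps field_simps)
    have P1: "?P (\<lambda>a. - J0 (Du a)) (- J0 (v p)) = ?P Du (v p)"
      by (simp add: pm orth)
    have P2: "?P (\<lambda>a. - J0 (Du a)) (v p) = - ?P Du (- J0 (v p))"
      using neg[OF blP[of "- J0 (v p)"]] by (simp add: pm skew)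
    have c1: "dorfman (\<lambda>_ _. 0) (\<lambda>q. fst (s q)) (\<lambda>q. fst (t q)) p =
        Dv (fst (u p)) - Du (fst (v p)) + (0, ?P Du (v p))"
      using dorfman_zero[OF du dv] by (simp add: u_def v_def)
    have c2: "dorfman (\<lambda>_ _. 0) (\<lambda>q. snd (s q)) (\<lambda>q. snd (t q)) p =
        - J0 (Dv (fst (- J0 (u p)))) + J0 (Du (fst (- J0 (v p)))) + (0, ?P Du (v p))"
      using dorfman_zero[OF du' dv'] by (simp add: P1[symmetric] su[OF p] tv[OF p])
    have c3: "dorfman (\<lambda>_ _. 0) (\<lambda>q. fst (s q)) (\<lambda>q. snd (t q)) p =
        - J0 (Dv (fst (u p))) - Du (fst (- J0 (v p))) + (0, ?P Du (- J0 (v p)))"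
      using dorfman_zero[OF du dv'] by (simp add: tv[OF p] u_def)
    have c4: "dorfman (\<lambda>_ _. 0) (\<lambda>q. snd (s q)) (\<lambda>q. fst (t q)) p =
        Dv (fst (- J0 (u p))) + J0 (Du (fst (v p))) - (0, ?P Du (- J0 (v p)))"
      using dorfman_zero[OF du' dv] by (simp only: P2 su[OF p]) (simp add: v_def prod_eq_iff)
    show ?thesis
      unfolding cdorfman_def Let_def c1 c2 c3 c4 i_eigenspace_def
      by (simp del: fst_uminus add: J0s algebra_simps)
  qed
  then show ?thesis
    unfolding generalized_complex_def
    using smooth_on_torus_const[of \<Lambda> "\<lambda>p. J p _"] by (auto simp: J lin orth sq)
qed

lemma inner_product_surj:
  fixes \<sigma> :: "'a::euclidean_space \<Rightarrow> 'a \<Rightarrow>\<^sub>L real"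
  assumes "inner_product \<sigma>"
  shows "bij \<sigma>"
proof -
  have lin: "linear \<sigma>" and pos: "\<And>x. x \<noteq> 0 \<Longrightarrow> blinfun_apply (\<sigma> x) x > 0"
    using assms by (auto simp: inner_product_def)
  have inj: "inj \<sigma>"
    using pos by (auto simp: linear_injective_0[OF lin]) (metis blinfun.zero_left less_irrefl)
  define A where "A x = (\<Sum>b\<in>Basis. blinfun_apply (\<sigma> x) b *\<^sub>R b)" for x
  have Ab: "A x \<bullet> b = blinfun_apply (\<sigma> x) b" if "b \<in> Basis" for x b
    using that by (simp add: A_def inner_sum_left inner_Basis if_distrib sum.delta cong: if_cong)
  have linA: "linear A"
    using lin by (auto intro!: linearI euclidean_eqI[where 'a='a]
        simp: Ab inner_simps linear_add linear_cmul blinfun.bilinear_simps)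
  have "inj A"
  proof (rule injI)
    fix x y assume "A x = A y"
    then have "\<sigma> x = \<sigma> y" by (intro blinfun_euclidean_eqI) (simp flip: Ab)
    then show "x = y" using inj by (simp add: injD)
  qed
  then have "surj A" using linA linear_injective_imp_surjective by blast
  have "\<exists>x. \<sigma> x = \<xi>" for \<xi>
  proof -
    obtain x where x: "A x = (\<Sum>b\<in>Basis. blinfun_apply \<xi> b *\<^sub>R b)"
      using \<open>surj A\<close> by (metis surjD)
    have "\<sigma> x = \<xi>"
    proof (rule blinfun_euclidean_eqI)
      fix b :: 'a assume b: "b \<in> Basis"
      then have "A x \<bullet> b = blinfun_apply \<xi> b"
        by (simp add: x inner_sum_left inner_Basis if_distrib sum.delta cong: if_cong)
      then show "blinfun_apply (\<sigma> x) b = blinfun_apply \<xi> b" by (simp add: Ab b)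
    qed
    then show ?thesis ..
  qed
  then have "surj \<sigma>" unfolding surj_def by metis
  then show ?thesis using inj by (simp add: bij_def)
qed

lemma gtan_decomposition:
  fixes \<sigma> :: "'a::euclidean_space \<Rightarrow> 'a \<Rightarrow>\<^sub>L real"
  assumes "inner_product \<sigma>"
  obtains a' a where "u = (a' - a, \<sigma> (a' + a))"
proof -
  obtain s where s: "snd u = \<sigma> s"
    using inner_product_surj[OF assms] by (metis bij_def surjD)
  have "(1/2) *\<^sub>R (s + x) - (1/2) *\<^sub>R (s - x) = x"
      "(1/2) *\<^sub>R (s + x) + (1/2) *\<^sub>R (s - x) = s" for x
    using scaleR_half_double[of x] scaleR_half_double[of s]
    by (simp_all add: scaleR_right_distrib scaleR_right_diff_distrib)
  then have "u = ((1/2) *\<^sub>R (s + fst u) - (1/2) *\<^sub>R (s - fst u),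
      \<sigma> ((1/2) *\<^sub>R (s + fst u) + (1/2) *\<^sub>R (s - fst u)))"
    by (simp add: prod_eq_iff s)
  then show thesis by (rule that)
qed

lemma linear_generalized_complex:
  fixes \<sigma> :: "'a::euclidean_space \<Rightarrow> 'a \<Rightarrow>\<^sub>L real"
  assumes \<sigma>: "inner_product \<sigma>"
    and Iplus: "orthogonal_complex_structure \<sigma> Iplus" and Iminus: "orthogonal_complex_structure \<sigma> Iminus"
    and K: "\<And>a a'. K (a' - a, \<sigma> (a' + a)) = (Iplus a' - Iminus a, \<sigma> (Iplus a' + Iminus a))"
  shows "linear K" "pairing (K u) (K v) = pairing u v" "K (K u) = - u"
proof -
  have lin: "linear \<sigma>" "linear Iplus" "linear Iminus"
    and sym: "\<And>x y. blinfun_apply (\<sigma> x) y = blinfun_apply (\<sigma> y) x"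
    and sq: "\<And>x. Iplus (Iplus x) = - x" "\<And>x. Iminus (Iminus x) = - x"
    and orth: "\<And>x y. blinfun_apply (\<sigma> (Iplus x)) (Iplus y) = blinfun_apply (\<sigma> x) y"
       "\<And>x y. blinfun_apply (\<sigma> (Iminus x)) (Iminus y) = blinfun_apply (\<sigma> x) y"
    using assms by (auto simp: inner_product_def orthogonal_complex_structure_def)
  have Kadd: "K ((a' - a, \<sigma> (a' + a)) + (b' - b, \<sigma> (b' + b)))
      = K (a' - a, \<sigma> (a' + a)) + K (b' - b, \<sigma> (b' + b))" for a a' b b'
  proof -
    have "(a' - a, \<sigma> (a' + a)) + (b' - b, \<sigma> (b' + b))
        = ((a' + b') - (a + b), \<sigma> ((a' + b') + (a + b)))"
      by (simp add: linear_add[OF lin(1)] algebra_simps)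
    then show ?thesis
      by (simp only: K)
         (simp add: linear_add[OF lin(1)] linear_add[OF lin(2)] linear_add[OF lin(3)] algebra_simps)
  qed
  have Kcmul: "K (c *\<^sub>R (a' - a, \<sigma> (a' + a))) = c *\<^sub>R K (a' - a, \<sigma> (a' + a))" for c a a'
  proof -
    have "c *\<^sub>R (a' - a, \<sigma> (a' + a)) = (c *\<^sub>R a' - c *\<^sub>R a, \<sigma> (c *\<^sub>R a' + c *\<^sub>R a))"
      by (simp add: linear_add[OF lin(1)] linear_cmul[OF lin(1)] algebra_simps)
    then show ?thesis
      by (simp only: K)
         (simp add: linear_add[OF lin(1)] linear_cmul[OF lin(1)] linear_cmul[OF lin(2)]
           linear_cmul[OF lin(3)] algebra_simps)
  qed
  show "linear K"
  proof (rule linearI)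
    show "K (x + y) = K x + K y" for x y
      by (rule gtan_decomposition[OF \<sigma>, of x], rule gtan_decomposition[OF \<sigma>, of y]) (simp only: Kadd)
    show "K (c *\<^sub>R x) = c *\<^sub>R K x" for c x
      by (rule gtan_decomposition[OF \<sigma>, of x]) (simp only: Kcmul)
  qed
  have pr: "pairing (a' - a, \<sigma> (a' + a)) (b' - b, \<sigma> (b' + b))
      = blinfun_apply (\<sigma> a') b' - blinfun_apply (\<sigma> a) b" for a a' b b'
    using sym[of a' b'] sym[of a b] sym[of a' b] sym[of a b']
    by (simp add: pairing_def linear_add[OF lin(1)] blinfun.bilinear_simps)
  obtain a' a where u: "u = (a' - a, \<sigma> (a' + a))" by (rule gtan_decomposition[OF \<sigma>])
  obtain b' b where v: "v = (b' - b, \<sigma> (b' + b))" by (rule gtan_decomposition[OF \<sigma>])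
  show "pairing (K u) (K v) = pairing u v"
    unfolding u v K pr orth ..
  show "K (K u) = - u"
    unfolding u K sq by (simp add: linear_add[OF lin(1)] linear_neg[OF lin(1)] linear_diff[OF lin(1)])
qed

lemma invariant_generalized_kahler_of_complex_structures:
  fixes \<sigma> :: "'a::euclidean_space \<Rightarrow> 'a \<Rightarrow>\<^sub>L real"
  assumes \<sigma>: "inner_product \<sigma>"
    and Iplus: "orthogonal_complex_structure \<sigma> Iplus" and Iminus: "orthogonal_complex_structure \<sigma> Iminus"
    and Jp: "\<And>p a a'. p \<in> torus \<Lambda> \<Longrightarrow>
          Jp p (a' - a, \<sigma> (a' + a)) = (Iplus a' - Iminus a, \<sigma> (Iplus a' + Iminus a))"
    and Jm: "\<And>p a a'. p \<in> torus \<Lambda> \<Longrightarrow>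
          Jm p (a' - a, \<sigma> (a' + a)) = (Iplus a' + Iminus a, \<sigma> (Iplus a' - Iminus a))"
  shows "invariant_generalized_kahler \<Lambda> (\<lambda>_ _. 0) Jp Jm (\<lambda>_. \<sigma>)"
proof -
  define e0 where "e0 = torus_exp \<Lambda> 0"
  have e0: "e0 \<in> torus \<Lambda>" by (simp add: e0_def torus_def)
  have lin: "linear \<sigma>" "linear Iplus" "linear Iminus"
    and sq: "\<And>x. Iplus (Iplus x) = - x" "\<And>x. Iminus (Iminus x) = - x"
    using assms(1-3) by (auto simp: inner_product_def orthogonal_complex_structure_def)
  have Iminus': "orthogonal_complex_structure \<sigma> (\<lambda>a. - Iminus a)"
    using Iminus unfolding orthogonal_complex_structure_def
    by (auto simp: linear_neg lin linear_compose_neg blinfun.bilinear_simps)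
  have Jp0: "Jp p = Jp e0" if p: "p \<in> torus \<Lambda>" for p
  proof
    show "Jp p u = Jp e0 u" for u
      by (rule gtan_decomposition[OF \<sigma>, of u]) (simp only: Jp[OF p] Jp[OF e0])
  qed
  have Jm0: "Jm p = Jm e0" if p: "p \<in> torus \<Lambda>" for p
  proof
    show "Jm p u = Jm e0 u" for u
      by (rule gtan_decomposition[OF \<sigma>, of u]) (simp only: Jm[OF p] Jm[OF e0])
  qed
  have "generalized_complex \<Lambda> (\<lambda>_ _. 0) Jp"
    using linear_generalized_complex[OF \<sigma> Iplus Iminus, of "Jp e0"] Jp[OF e0] Jp0
    by (intro generalized_complex_invariant[of "Jp e0"]) auto
  moreover have "generalized_complex \<Lambda> (\<lambda>_ _. 0) Jm"
    using linear_generalized_complex[OF \<sigma> Iplus Iminus', of "Jm e0"] Jm[OF e0] Jm0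
    by (intro generalized_complex_invariant[of "Jm e0"]) auto
  moreover have "closed_three_form \<Lambda> (\<lambda>_ _. 0)"
    by (auto simp: closed_three_form_def smooth_form_def alt_form_def linear_iff
        ext_deriv_def inv_deriv_def smooth_on_torus_const)
  moreover have "riemannian_metric \<Lambda> (\<lambda>_. \<sigma>)"
    by (simp add: riemannian_metric_def \<sigma> smooth_on_torus_const)
  moreover have "Jp p (Jm p u) = (- inv \<sigma> (snd u), - \<sigma> (fst u))"
      "Jm p (Jp p u) = (- inv \<sigma> (snd u), - \<sigma> (fst u))" if p: "p \<in> torus \<Lambda>" for p u
  proof -
    obtain a' a where u: "u = (a' - a, \<sigma> (a' + a))" by (rule gtan_decomposition[OF \<sigma>])
    have "inv \<sigma> (\<sigma> (a' + a)) = a' + a"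
      using inner_product_surj[OF \<sigma>] by (simp add: bij_def)
    then have i: "inv \<sigma> (\<sigma> a' + \<sigma> a) = a' + a"
      by (simp add: linear_add lin)
    show "Jp p (Jm p u) = (- inv \<sigma> (snd u), - \<sigma> (fst u))"
      using Jp[OF p, of "Iplus a'" "- Iminus a"]
      unfolding u Jm[OF p] by (simp add: i linear_neg lin sq linear_diff linear_add)
    show "Jm p (Jp p u) = (- inv \<sigma> (snd u), - \<sigma> (fst u))"
      using Jm[OF p, of "Iplus a'" "Iminus a"]
      unfolding u Jp[OF p] by (simp add: i linear_neg lin sq linear_diff linear_add)
  qed
  ultimately show ?thesis
    unfolding invariant_generalized_kahler_def generalized_kahler_def translation_invariant_def
    using Jp0 Jm0 Jp0[OF translate_in_torus] Jm0[OF translate_in_torus] by simp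
qed
end

theory Submission
  imports Defs
begin

text \<open>
  In the trivialisation by invariant vector fields, the structures are constant. Their integrability
  says that the constant 3-form \<open>\<gamma>\<close> satisfies \<open>\<gamma>(I x, I y, z) = \<gamma>(x, y, z)\<close> for the complex structure
  \<open>I\<close> induced on \<open>{(x, g x)}\<close>, and this forces \<open>\<gamma> = 0\<close>. So every constant pure spinor is a closed
  section of the canonical bundle. To compare lengths, choose an orthogonal family \<open>x\<^sub>1, \<dots>, x\<^sub>m\<close>
  which together with its image under the second induced complex structure is an orthogonal basis.
  If \<open>\<phi>\<close> is a pure spinor of \<open>J\<^sub>+\<close>, then \<open>\<psi> = y\<^sub>1 \<cdots> y\<^sub>m \<cdot> \<phi>\<close> with \<open>y\<^sub>k = (x\<^sub>k, - g x\<^sub>k)\<close> is one of \<open>J\<^sub>-\<close>.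
  As the Clifford action is self-adjoint for the Mukai pairing and \<open>y\<^sub>k \<cdot> y\<^sub>k \<cdot> \<phi> = \<langle>y\<^sub>k, y\<^sub>k\<rangle> \<phi>\<close>, the lengths of
  \<open>\<psi>\<close> and \<open>\<phi>\<close> differ by the nonzero factor \<open>\<Prod>\<langle>y\<^sub>k, y\<^sub>k\<rangle>\<close>.
\<close>

section \<open>The wedge product\<close>

lemma wedge_Nil: "wedge \<alpha> \<beta> [] = \<alpha> [] * \<beta> []"
  by (simp add: wedge_def)

text \<open>The sign \<open>(-1) ^ k\<close> in degree \<open>k\<close>, picked up whenever a
  contraction moves past \<alpha>. With it, contraction becomes an antiderivation of
  \<open>wedge\<close>.\<close>

definition grade_inv :: "('a list \<Rightarrow> 'b::comm_ring_1) \<Rightarrow> 'a list \<Rightarrow> 'b" where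
  "grade_inv \<alpha> vs = (-1) ^ length vs * \<alpha> vs"

text \<open>The shuffles are split by whether position 0 goes to \<alpha> or to \<beta>. This
  antiderivation rule replaces the sum over shuffles in all later inductions on the argument
  list.\<close>

lemma wedge_Cons:
  "wedge \<alpha> \<beta> (v # vs) =
     wedge (\<lambda>us. \<alpha> (v # us)) \<beta> vs + wedge (grade_inv \<alpha>) (\<lambda>us. \<beta> (v # us)) vs"
proof -
  define n where "n = length vs"
  define P where "P m A = {(i, j). i \<in> A \<and> j \<in> {..<m} - A \<and> j < i}" for m and A :: "nat set"
  let ?F = "\<lambda>A. (-1) ^ card (P (Suc n) A) * \<alpha> (nths (v # vs) A) * \<beta> (nths (v # vs) (- A))"
  have PowSuc: "Pow {..<Suc n} = (`) Suc ` Pow {..<n} \<union> (\<lambda>B. insert 0 (Suc ` B)) ` Pow {..<n}"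
    by (simp add: lessThan_Suc_eq_insert_0 Pow_insert image_Pow_surj[of Suc, symmetric] image_image)
  have inj: "inj_on ((`) Suc) (Pow {..<n})" "inj_on (\<lambda>B. insert 0 (Suc ` B)) (Pow {..<n})"
    by (auto intro!: inj_onI)
  have finP: "finite (P n B)" if "B \<subseteq> {..<n}" for B
    using that finite_subset[of B "{..<n}"]
    by (intro finite_subset[of "P n B" "B \<times> {..<n}"]) (auto simp: P_def)
  have injm: "inj_on (map_prod Suc Suc) X" for X
    by (auto simp: inj_on_def)
  have "P (Suc n) (Suc ` B) = map_prod Suc Suc ` P n B \<union> Suc ` B \<times> {0}" for B
    by (auto simp: P_def image_iff less_Suc_eq_0_disj)
  \<comment> \<open>If position 0 goes to \<beta>, it is out of order with each of the
    \<open>card B\<close> positions of \<alpha>; if it goes to \<alpha>, no new inversion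
    arises.\<close>
  then have c1: "card (P (Suc n) (Suc ` B)) = card (P n B) + card B" if "B \<subseteq> {..<n}" for B
    using that finP[OF that] finite_subset[of B "{..<n}"]
    by (simp, subst card_Un_disjoint)
       (auto simp: card_image[OF injm] card_image card_cartesian_product)
  have "P (Suc n) (insert 0 (Suc ` B)) = map_prod Suc Suc ` P n B" for B
    by (auto simp: P_def image_iff less_Suc_eq_0_disj)
  then have c2: "card (P (Suc n) (insert 0 (Suc ` B))) = card (P n B)" for B
    by (simp add: card_image[OF injm])
  have len: "length (nths vs B) = card B" if "B \<subseteq> {..<n}" for B
    using that by (auto simp: length_nths n_def intro!: arg_cong[of _ _ card])
  have nth: "nths (v # vs) (Suc ` B) = nths vs B" "nths (v # vs) (- (Suc ` B)) = v # nths vs (- B)"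
    "nths (v # vs) (insert 0 (Suc ` B)) = v # nths vs B"
    "nths (v # vs) (- insert 0 (Suc ` B)) = nths vs (- B)" for B
    by (auto simp: nths_Cons Compl_eq image_iff intro!: arg_cong[of _ _ "nths vs"])
  have "wedge \<alpha> \<beta> (v # vs) = (\<Sum>A\<in>Pow {..<Suc n}. ?F A)"
    by (simp add: wedge_def P_def n_def)
  also have "\<dots> = (\<Sum>B\<in>Pow {..<n}. ?F (Suc ` B)) + (\<Sum>B\<in>Pow {..<n}. ?F (insert 0 (Suc ` B)))"
    unfolding PowSuc
    by (subst sum.union_disjoint) (auto simp: sum.reindex inj)
  also have "(\<Sum>B\<in>Pow {..<n}. ?F (Suc ` B)) = wedge (grade_inv \<alpha>) (\<lambda>us. \<beta> (v # us)) vs"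
    unfolding wedge_def n_def[symmetric] P_def[symmetric]
    by (intro sum.cong) (auto simp: c1 nth len grade_inv_def power_add)
  also have "(\<Sum>B\<in>Pow {..<n}. ?F (insert 0 (Suc ` B))) = wedge (\<lambda>us. \<alpha> (v # us)) \<beta> vs"
    unfolding wedge_def n_def[symmetric] P_def[symmetric]
    by (intro sum.cong) (auto simp: c2 nth)
  finally show ?thesis by simp
qed

lemma wedge_add_left: "wedge (\<lambda>us. \<alpha> us + \<alpha>' us) \<beta> vs = wedge \<alpha> \<beta> vs + wedge \<alpha>' \<beta> vs"
  by (simp add: wedge_def algebra_simps sum.distrib)

lemma wedge_add_right: "wedge \<alpha> (\<lambda>us. \<beta> us + \<beta>' us) vs = wedge \<alpha> \<beta> vs + wedge \<alpha> \<beta>' vs"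
  by (simp add: wedge_def algebra_simps sum.distrib)

lemma wedge_mult_left: "wedge (\<lambda>us. c * \<alpha> us) \<beta> vs = c * wedge \<alpha> \<beta> vs"
  by (simp add: wedge_def sum_distrib_left mult_ac)

lemma wedge_mult_right: "wedge \<alpha> (\<lambda>us. c * \<beta> us) vs = c * wedge \<alpha> \<beta> vs"
  by (simp add: wedge_def sum_distrib_left mult_ac)

lemma wedge_minus_left: "wedge (\<lambda>us. - \<alpha> us) \<beta> vs = - wedge \<alpha> \<beta> vs"
  by (simp add: wedge_def sum_negf)

lemma wedge_minus_right: "wedge \<alpha> (\<lambda>us. - \<beta> us) vs = - wedge \<alpha> \<beta> vs"
  by (simp add: wedge_def sum_negf)

lemma wedge_zero_left: "wedge (\<lambda>us. 0) \<beta> vs = 0"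
  by (simp add: wedge_def)

lemma wedge_zero_right: "wedge \<alpha> (\<lambda>us. 0) vs = 0"
  by (simp add: wedge_def)

section \<open>Grade involution, associativity and reversal\<close>

lemma grade_inv_Cons: "(\<lambda>us. grade_inv \<alpha> (v # us)) = (\<lambda>us. - grade_inv (\<lambda>us. \<alpha> (v # us)) us)"
  by (simp add: grade_inv_def fun_eq_iff)

lemma grade_inv_snoc: "(\<lambda>us. grade_inv \<alpha> (us @ [v])) = (\<lambda>us. - grade_inv (\<lambda>us. \<alpha> (us @ [v])) us)"
  by (simp add: grade_inv_def fun_eq_iff)

lemma grade_inv_grade_inv: "grade_inv (grade_inv \<alpha>) = \<alpha>"
  by (simp add: grade_inv_def fun_eq_iff flip: mult.assoc power_add)

lemma grade_inv_wedge: "grade_inv (wedge \<alpha> \<beta>) vs = wedge (grade_inv \<alpha>) (grade_inv \<beta>) vs"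
proof (induction vs arbitrary: \<alpha> \<beta>)
  case Nil
  then show ?case by (simp add: wedge_Nil grade_inv_def)
next
  case (Cons v vs)
  have "grade_inv (wedge \<alpha> \<beta>) (v # vs) =
     - grade_inv (wedge (\<lambda>us. \<alpha> (v # us)) \<beta>) vs - grade_inv (wedge (grade_inv \<alpha>) (\<lambda>us. \<beta> (v # us))) vs"
    by (simp add: grade_inv_def wedge_Cons algebra_simps)
  then show ?case
    by (simp add: Cons wedge_Cons grade_inv_Cons wedge_minus_left wedge_minus_right)
qed

text \<open>Both sides satisfy the same recursion in the first argument, once
  \<open>grade_inv\<close> is known to be multiplicative; no triple shuffles have to be
  counted.\<close>

lemma wedge_assoc: "wedge (wedge \<alpha> \<beta>) \<delta> vs = wedge \<alpha> (wedge \<beta> \<delta>) vs"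
proof (induction vs arbitrary: \<alpha> \<beta> \<delta>)
  case Nil
  then show ?case by (simp add: wedge_Nil mult.assoc)
next
  case (Cons v vs)
  have "grade_inv (wedge \<alpha> \<beta>) = wedge (grade_inv \<alpha>) (grade_inv \<beta>)"
    by (simp add: fun_eq_iff grade_inv_wedge)
  then show ?case
    by (simp add: Cons wedge_Cons wedge_add_left wedge_add_right)
qed

text \<open>The mirror image of \<open>wedge_Cons\<close>: contraction in the last slot comes from
  the right, so the sign falls on \<beta>. It is what reversing the arguments calls for.\<close>

lemma wedge_snoc:
  "wedge \<alpha> \<beta> (vs @ [x]) =
     wedge (\<lambda>us. \<alpha> (us @ [x])) (grade_inv \<beta>) vs + wedge \<alpha> (\<lambda>us. \<beta> (us @ [x])) vs"
proof (induction vs arbitrary: \<alpha> \<beta>)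
  case Nil
  then show ?case by (simp add: wedge_Nil wedge_Cons grade_inv_def)
next
  case (Cons v vs)
  then show ?case
    by (simp add: wedge_Cons grade_inv_Cons grade_inv_snoc wedge_minus_left wedge_minus_right)
qed

lemma grade_inv_reversal: "grade_inv (reversal \<alpha>) = reversal (grade_inv \<alpha>)"
  by (simp add: fun_eq_iff grade_inv_def reversal_def)

lemma reversal_wedge: "reversal (wedge \<alpha> \<beta>) vs = wedge (reversal \<beta>) (reversal \<alpha>) vs"
proof (induction vs arbitrary: \<alpha> \<beta>)
  case Nil
  then show ?case by (simp add: wedge_Nil reversal_def mult.commute)
next
  case (Cons v vs)
  then show ?case
    by (simp add: wedge_Cons wedge_snoc reversal_def[of _ "v # vs"] grade_inv_reversal)
       (simp add: reversal_def[abs_def])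
qed

lemma wedge_scalar:
  fixes c :: "'b::comm_ring_1" and \<beta> :: "'a list \<Rightarrow> 'b"
  shows "wedge (\<lambda>us. if us = [] then c else 0) \<beta> vs = c * \<beta> vs"
proof (induction vs arbitrary: \<beta>)
  case Nil
  then show ?case by (simp add: wedge_Nil)
next
  case (Cons v vs)
  have "grade_inv (\<lambda>us :: 'a list. if us = [] then c else 0) = (\<lambda>us. if us = [] then c else 0)"
    by (simp add: fun_eq_iff grade_inv_def)
  with Cons show ?case by (simp add: wedge_Cons wedge_zero_left)
qed

section \<open>Alternating forms\<close>

lemma alt_form_linear: "alt_form \<phi> \<Longrightarrow> linear (\<lambda>v. \<phi> (us @ v # vs))"
  unfolding alt_form_def by blast

lemma alt_form_linear_Cons: "alt_form \<phi> \<Longrightarrow> linear (\<lambda>v. \<phi> (v # vs))"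
  using alt_form_linear[of \<phi> "[]" vs] by simp

lemma alt_form_swap:
  assumes "alt_form \<phi>"
  shows "\<phi> (us @ a # b # vs) = - \<phi> (us @ b # a # vs)"
proof -
  have lin: "linear (\<lambda>v. \<phi> (us @ v # vs))" for us vs
    using assms by (simp add: alt_form_def)
  have add: "\<phi> (us @ (x + y) # vs) = \<phi> (us @ x # vs) + \<phi> (us @ y # vs)" for us x y vs
    using linear_add[OF lin] .
  have add2: "\<phi> (us @ c # (x + y) # vs) = \<phi> (us @ c # x # vs) + \<phi> (us @ c # y # vs)" for us c x y vs
    using add[of "us @ [c]"] by simp
  have adj: "\<phi> (us @ x # x # vs) = 0" for x
    using assms by (simp add: alt_form_def)
  have "0 = \<phi> (us @ (a + b) # (a + b) # vs)" by (simp add: adj)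
  also have "\<dots> = \<phi> (us @ a # b # vs) + \<phi> (us @ b # a # vs)"
    by (simp only: add add2) (simp add: adj)
  finally show ?thesis by (simp only: eq_neg_iff_add_eq_0)
qed

lemma alt_form_swap': "alt_form \<phi> \<Longrightarrow> \<phi> (a # b # vs) = - \<phi> (b # a # vs)"
  using alt_form_swap[of \<phi> "[]" a b vs] by simp

text \<open>Vanishing on adjacent equal entries gives antisymmetry by polarization, and
  transpositions then bring any two equal entries together. For wedge products only the adjacent
  case is convenient to check.\<close>

lemma alt_formI_adjacent:
  assumes lin: "\<And>us vs. linear (\<lambda>v. \<phi> (us @ v # vs))" and adj: "\<And>us v vs. \<phi> (us @ v # v # vs) = 0"
  shows "alt_form \<phi>"
proof -
  have add: "\<phi> (us @ (x + y) # vs) = \<phi> (us @ x # vs) + \<phi> (us @ y # vs)" for us x y vs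
    using linear_add[OF lin] .
  have add2: "\<phi> (us @ c # (x + y) # vs) = \<phi> (us @ c # x # vs) + \<phi> (us @ c # y # vs)" for us c x y vs
    using add[of "us @ [c]"] by simp
  have swap: "\<phi> (us @ a # b # vs) = - \<phi> (us @ b # a # vs)" for us a b vs
  proof -
    have "0 = \<phi> (us @ (a + b) # (a + b) # vs)" by (simp add: adj)
    also have "\<dots> = \<phi> (us @ a # b # vs) + \<phi> (us @ b # a # vs)"
      by (simp only: add add2) (simp add: adj)
    finally show ?thesis by (simp only: eq_neg_iff_add_eq_0)
  qed
  have "\<phi> (us @ v # ms @ v # vs) = 0" for us v ms vs
  proof (induction ms arbitrary: us)
    case Nil
    then show ?case by (simp add: adj)
  next
    case (Cons m ms)
    show ?case using Cons[of "us @ [m]"] swap[of us v m "ms @ v # vs"] by simp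
  qed
  then have "\<phi> vs = 0" if "\<not> distinct vs" for vs
    using not_distinct_decomp[OF that] by (metis append_Cons append_Nil)
  with lin show ?thesis unfolding alt_form_def by blast
qed

lemma alt_form_Cons:
  assumes "alt_form \<phi>"
  shows "alt_form (\<lambda>us. \<phi> (v # us))"
proof -
  have "linear (\<lambda>x. \<phi> ((v # us) @ x # vs))" for us vs
    using assms unfolding alt_form_def by blast
  with assms show ?thesis by (simp add: alt_form_def)
qed

lemma linear_cmult_real:
  fixes c :: "'b::real_normed_algebra"
  assumes "linear f" shows "linear (\<lambda>x. c * f x)"
  using assms by (simp add: linear_iff distrib_left)

lemma alt_form_cmult:
  fixes \<phi> :: "'a::real_vector list \<Rightarrow> 'b::real_normed_algebra"
  assumes "alt_form \<phi>" shows "alt_form (\<lambda>us. c * \<phi> us)"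
  using assms by (simp add: alt_form_def linear_cmult_real)

lemma alt_form_add:
  assumes "alt_form \<phi>" "alt_form \<psi>" shows "alt_form (\<lambda>us. \<phi> us + \<psi> us)"
  using assms by (simp add: alt_form_def linear_compose_add)

lemma alt_form_grade_inv:
  fixes \<phi> :: "'a::real_vector list \<Rightarrow> 'b::real_normed_field"
  assumes "alt_form \<phi>" shows "alt_form (grade_inv \<phi>)"
proof -
  have "(\<lambda>v. grade_inv \<phi> (us @ v # vs)) = (\<lambda>v. (-1) ^ Suc (length us + length vs) * \<phi> (us @ v # vs))" for us vs
    by (simp add: grade_inv_def)
  then have "linear (\<lambda>v. grade_inv \<phi> (us @ v # vs))" for us vs
    using assms linear_cmult_real[of "\<lambda>v. \<phi> (us @ v # vs)"] by (simp only: alt_form_def)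
  moreover have "grade_inv \<phi> vs = 0" if "\<not> distinct vs" for vs
    using assms that by (simp add: alt_form_def grade_inv_def)
  ultimately show ?thesis by (simp add: alt_form_def)
qed

lemma alt_form_reversal:
  assumes "alt_form \<phi>" shows "alt_form (reversal \<phi>)"
  using assms by (simp add: alt_form_def reversal_def)

lemma alt_form_wedge:
  fixes \<alpha> \<beta> :: "'a::real_vector list \<Rightarrow> 'b::real_normed_field"
  assumes "alt_form \<alpha>" "alt_form \<beta>"
  shows "alt_form (wedge \<alpha> \<beta>)"
proof (rule alt_formI_adjacent)
  show "linear (\<lambda>v. wedge \<alpha> \<beta> (us @ v # vs))" for us vs
    using assms
  proof (induction us arbitrary: \<alpha> \<beta>)
    case Nil
    note lin = alt_form_linear_Cons[OF Nil(1)] alt_form_linear_Cons[OF Nil(2)]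
    show ?case
    proof (rule linearI)
      show "wedge \<alpha> \<beta> ([] @ (x + y) # vs) = wedge \<alpha> \<beta> ([] @ x # vs) + wedge \<alpha> \<beta> ([] @ y # vs)" for x y
        by (simp add: wedge_Cons linear_add[OF lin(1)] linear_add[OF lin(2)] wedge_add_left wedge_add_right)
      show "wedge \<alpha> \<beta> ([] @ (r *\<^sub>R x) # vs) = r *\<^sub>R wedge \<alpha> \<beta> ([] @ x # vs)" for r x
        by (simp add: wedge_Cons linear_cmul[OF lin(1)] linear_cmul[OF lin(2)] scaleR_conv_of_real
            wedge_mult_left wedge_mult_right distrib_left)
    qed
  next
    case (Cons u us)
    then show ?case
      by (simp add: wedge_Cons linear_compose_add alt_form_Cons alt_form_grade_inv)
  qed
  show "wedge \<alpha> \<beta> (us @ v # v # vs) = 0" for us v vs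
    using assms
  proof (induction us arbitrary: \<alpha> \<beta>)
    case Nil
    then have "\<alpha> (v # v # us) = 0" "\<beta> (v # v # us) = 0" for us
      by (simp_all add: alt_form_def)
    then show ?case
      by (simp add: wedge_Cons grade_inv_Cons wedge_minus_left wedge_zero_left wedge_zero_right)
  next
    case (Cons u us)
    then show ?case
      by (simp add: wedge_Cons alt_form_Cons alt_form_grade_inv)
  qed
qed

text \<open>More than \<open>DIM('a)\<close> distinct vectors are dependent, so some entry lies in
  the span of the others; the form is linear in that slot and vanishes on each of the
  others.\<close>

lemma alt_form_above_dim:
  fixes \<phi> :: "'a::euclidean_space list \<Rightarrow> 'b::real_vector"
  assumes "alt_form \<phi>" "length vs > DIM('a)"
  shows "\<phi> vs = 0"
proof (cases "distinct vs")
  case True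
  then have "card (set vs) > DIM('a)" using assms(2) by (simp add: distinct_card)
  then have "dependent (set vs)" using independent_bound by fastforce
  then obtain v where v: "v \<in> set vs" "v \<in> span (set vs - {v})"
    unfolding dependent_def by blast
  then obtain us ws where vs: "vs = us @ v # ws" by (meson split_list)
  have lin: "linear (\<lambda>x. \<phi> (us @ x # ws))" using assms(1) by (simp add: alt_form_def)
  have "\<phi> (us @ x # ws) = 0" if "x \<in> set vs - {v}" for x
    using that assms(1) by (auto simp: vs alt_form_def)
  from linear_eq_0_on_span[OF lin this v(2)] show ?thesis by (simp add: vs)
qed (use assms in \<open>auto simp: alt_form_def\<close>)

lemma alt_form_snoc:
  fixes \<phi> :: "'a::real_vector list \<Rightarrow> 'b::real_normed_field"
  assumes "alt_form \<phi>"
  shows "\<phi> (us @ [x]) = (-1) ^ length us * \<phi> (x # us)"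
  using assms
proof (induction us arbitrary: \<phi>)
  case (Cons u us)
  then show ?case
    using Cons.IH[OF alt_form_Cons[of \<phi> u]] alt_form_swap'[of \<phi> u x us] by simp
qed simp

section \<open>The Clifford action and the Mukai pairing\<close>

lemma alt_form_one_form: "alt_form (\<lambda>us. of_real (one_form \<xi> us) :: complex)"
proof -
  have "linear (\<lambda>v. of_real (one_form \<xi> (us @ v # vs)) :: complex)" for us vs
    by (cases us) (auto simp: one_form_def linear_iff blinfun.bilinear_simps scaleR_conv_of_real)
  moreover have "one_form \<xi> vs = 0" if "\<not> distinct vs" for vs
    using that by (cases vs) (auto simp: one_form_def)
  ultimately show ?thesis by (simp add: alt_form_def)
qed

lemma wedge_one_form_Nil: "wedge (\<lambda>us. of_real (one_form \<xi> us)) \<phi> [] = (0 :: complex)"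
  by (simp add: wedge_Nil one_form_def)

text \<open>The antiderivation rule for a factor of degree 1: its contraction is a scalar and its
  grade sign is -1.\<close>

lemma wedge_one_form_Cons:
  fixes \<phi> :: "'a::real_normed_vector list \<Rightarrow> complex"
  shows "wedge (\<lambda>us. of_real (one_form \<xi> us)) \<phi> (v # vs) =
     of_real (blinfun_apply \<xi> v) * \<phi> vs - wedge (\<lambda>us. of_real (one_form \<xi> us)) (\<lambda>us. \<phi> (v # us)) vs"
proof -
  have "(\<lambda>us. of_real (one_form \<xi> (v # us)) :: complex) =
      (\<lambda>us. if us = [] then of_real (blinfun_apply \<xi> v) else 0)"
    by (auto simp: one_form_def)
  moreover have "grade_inv (\<lambda>us. of_real (one_form \<xi> us) :: complex) = (\<lambda>us. - of_real (one_form \<xi> us))"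
    by (auto simp: grade_inv_def one_form_def)
  ultimately show ?thesis
    by (simp add: wedge_Cons wedge_scalar wedge_minus_left)
qed

lemma wedge_one_form_anticommute:
  fixes \<phi> :: "'a::real_normed_vector list \<Rightarrow> complex"
  shows "wedge (\<lambda>us. of_real (one_form \<xi> us)) (wedge (\<lambda>us. of_real (one_form \<eta> us)) \<phi>) vs =
     - wedge (\<lambda>us. of_real (one_form \<eta> us)) (wedge (\<lambda>us. of_real (one_form \<xi> us)) \<phi>) vs"
proof (induction vs arbitrary: \<phi>)
  case Nil
  then show ?case by (simp add: wedge_one_form_Nil)
next
  case (Cons v vs)
  have "wedge (\<lambda>us. of_real (one_form \<zeta> us)) (wedge (\<lambda>us. of_real (one_form \<theta> us)) \<phi>) (v # vs) =
      of_real (blinfun_apply \<zeta> v) * wedge (\<lambda>us. of_real (one_form \<theta> us)) \<phi> vs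
      - of_real (blinfun_apply \<theta> v) * wedge (\<lambda>us. of_real (one_form \<zeta> us)) \<phi> vs
      + wedge (\<lambda>us. of_real (one_form \<zeta> us))
          (wedge (\<lambda>us. of_real (one_form \<theta> us)) (\<lambda>us. \<phi> (v # us))) vs" for \<zeta> \<theta> :: "'a \<Rightarrow>\<^sub>L real"
    by (simp add: wedge_one_form_Cons wedge_add_right wedge_mult_right wedge_minus_right
        diff_conv_add_uminus del: add_uminus_conv_diff)
  then show ?case
    using Cons.IH[of "\<lambda>us. \<phi> (v # us)"] by simp
qed

text \<open>Contractions anticommute with each other, and so do multiplications by 1-forms. Only the
  mixed terms survive, each leaving the value of one covector on the other vector.\<close>

lemma spin_act_clifford:
  assumes "alt_form \<phi>"
  shows "spin_act u (spin_act v \<phi>) vs + spin_act v (spin_act u \<phi>) vs =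
    of_real (2 * pairing u v) * \<phi> vs"
  unfolding spin_act_def
  using alt_form_swap'[OF assms, of "fst u" "fst v" vs] wedge_one_form_anticommute[of "snd u" "snd v" \<phi> vs]
  by (simp add: wedge_one_form_Cons wedge_add_right pairing_def algebra_simps)

lemma spin_act_square:
  assumes "alt_form \<phi>"
  shows "spin_act u (spin_act u \<phi>) vs = of_real (pairing u u) * \<phi> vs"
  using spin_act_clifford[OF assms, of u u vs] by simp

lemma alt_form_spin_act: "alt_form \<phi> \<Longrightarrow> alt_form (spin_act u \<phi>)"
  unfolding spin_act_def
  by (intro alt_form_add alt_form_Cons alt_form_wedge alt_form_one_form)

lemma alt_form_cspin_act: "alt_form \<phi> \<Longrightarrow> alt_form (cspin_act w \<phi>)"
  unfolding cspin_act_def by (intro alt_form_add alt_form_cmult alt_form_spin_act)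

lemma spin_act_add_right:
  "spin_act u (\<lambda>us. \<phi> us + \<psi> us) vs = spin_act u \<phi> vs + spin_act u \<psi> vs"
  by (simp add: spin_act_def wedge_add_right)

lemma spin_act_mult_right: "spin_act u (\<lambda>us. c * \<phi> us) vs = c * spin_act u \<phi> vs"
  by (simp add: spin_act_def wedge_mult_right distrib_left)

lemma spin_act_zero_right: "spin_act u (\<lambda>us. 0) vs = 0"
  by (simp add: spin_act_def wedge_zero_right)

lemma spin_act_linear_left:
  assumes "alt_form \<phi>"
  shows "linear (\<lambda>u. spin_act u \<phi> vs)"
proof (rule linearI)
  have lin: "linear (\<lambda>v. \<phi> (v # vs))"
    using assms by (rule alt_form_linear_Cons)
  have add: "(\<lambda>us. of_real (one_form (\<xi> + \<eta>) us) :: complex) =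
      (\<lambda>us. of_real (one_form \<xi> us) + of_real (one_form \<eta> us))"
    and cmul: "(\<lambda>us. of_real (one_form (r *\<^sub>R \<xi>) us) :: complex) =
      (\<lambda>us. of_real r * of_real (one_form \<xi> us))" for \<xi> \<eta> :: "'a \<Rightarrow>\<^sub>L real" and r
    by (auto simp: one_form_def blinfun.bilinear_simps)
  show "spin_act (u + v) \<phi> vs = spin_act u \<phi> vs + spin_act v \<phi> vs" for u v
    by (simp add: spin_act_def linear_add[OF lin] add wedge_add_left)
  show "spin_act (r *\<^sub>R u) \<phi> vs = r *\<^sub>R spin_act u \<phi> vs" for r u
    by (simp add: spin_act_def linear_cmul[OF lin] cmul wedge_mult_left scaleR_conv_of_real distrib_left)
qed

text \<open>The two conditions in \<open>iso\<close> are the real and imaginary parts of the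
  vanishing of the complex bilinear pairing of \<open>w\<close> and \<open>z\<close>.\<close>

lemma cspin_act_anticommute:
  assumes \<phi>: "alt_form \<phi>"
    and iso: "pairing (fst w) (fst z) = pairing (snd w) (snd z)"
      "pairing (fst w) (snd z) = - pairing (snd w) (fst z)"
  shows "cspin_act w (cspin_act z \<phi>) vs = - cspin_act z (cspin_act w \<phi>) vs"
proof -
  have "cspin_act w (cspin_act z \<phi>) vs + cspin_act z (cspin_act w \<phi>) vs =
      (spin_act (fst w) (spin_act (fst z) \<phi>) vs + spin_act (fst z) (spin_act (fst w) \<phi>) vs)
      - (spin_act (snd w) (spin_act (snd z) \<phi>) vs + spin_act (snd z) (spin_act (snd w) \<phi>) vs)
      + \<i> * (spin_act (fst w) (spin_act (snd z) \<phi>) vs + spin_act (snd z) (spin_act (fst w) \<phi>) vs)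
      + \<i> * (spin_act (snd w) (spin_act (fst z) \<phi>) vs + spin_act (fst z) (spin_act (snd w) \<phi>) vs)"
    unfolding cspin_act_def
    by (simp add: spin_act_add_right spin_act_mult_right algebra_simps flip: mult.assoc)
  also have "\<dots> = 0"
    unfolding spin_act_clifford[OF \<phi>] iso by (simp add: algebra_simps)
  finally show ?thesis by (simp only: eq_neg_iff_add_eq_0)
qed

text \<open>Contracting a form of degree \<open>DIM('a) + 1\<close>, which is zero, gives this identity.\<close>

lemma wedge_contract_move:
  fixes \<alpha> \<psi> :: "'a::euclidean_space list \<Rightarrow> complex"
  assumes \<alpha>: "alt_form \<alpha>" and \<psi>: "alt_form \<psi>" and len: "length vs = DIM('a)"
  shows "wedge (\<lambda>us. \<alpha> (us @ [x])) \<psi> vs = wedge \<alpha> (\<lambda>us. \<psi> (x # us)) vs"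
proof -
  have "wedge (grade_inv \<alpha>) \<psi> (x # vs) = 0"
    using len by (intro alt_form_above_dim alt_form_wedge alt_form_grade_inv \<alpha> \<psi>) simp
  moreover have "(\<lambda>us. \<alpha> (us @ [x])) = (\<lambda>us. - grade_inv \<alpha> (x # us))"
    by (simp add: fun_eq_iff alt_form_snoc[OF \<alpha>] grade_inv_def)
  ultimately show ?thesis
    by (simp add: wedge_Cons grade_inv_grade_inv wedge_minus_left add_eq_0_iff)
qed

text \<open>Reversal turns left multiplication by a 1-form into right multiplication, which
  associativity passes to \<psi>. It turns contraction in the first slot into contraction in the
  last, which \<open>wedge_contract_move\<close> passes to \<psi>.\<close>

lemma mukai_spin_act:
  fixes \<phi> \<psi> :: "'a::euclidean_space list \<Rightarrow> complex"
  assumes \<phi>: "alt_form \<phi>" and \<psi>: "alt_form \<psi>"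
  shows "mukai (spin_act u \<phi>) \<psi> vs = mukai \<phi> (spin_act u \<psi>) vs"
proof (cases "length vs = DIM('a)")
  case True
  let ?\<xi> = "\<lambda>us. of_real (one_form (snd u) us) :: complex"
  have "reversal ?\<xi> = ?\<xi>"
    by (auto simp: reversal_def one_form_def fun_eq_iff length_Suc_conv)
  then have "reversal (wedge ?\<xi> \<phi>) = wedge (reversal \<phi>) ?\<xi>"
    by (intro ext) (simp only: reversal_wedge)
  then have "reversal (spin_act u \<phi>) =
      (\<lambda>us. reversal \<phi> (us @ [fst u]) + wedge (reversal \<phi>) ?\<xi> us)"
    by (simp add: fun_eq_iff spin_act_def reversal_def)
  then show ?thesis
    using True wedge_contract_move[OF alt_form_reversal[OF \<phi>] \<psi> True]
    by (simp add: mukai_def wedge_add_left wedge_assoc spin_act_def[abs_def] wedge_add_right)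
qed (simp add: mukai_def)

lemma cnj_spin_act: "cnj (spin_act u \<phi> vs) = spin_act u (\<lambda>us. cnj (\<phi> us)) vs"
  by (simp add: spin_act_def wedge_def cnj_sum)

lemma alt_form_cnj: "alt_form \<phi> \<Longrightarrow> alt_form (\<lambda>us. cnj (\<phi> us))"
  by (simp add: alt_form_def linear_iff)

lemma mukai_mult_right: "mukai \<phi> (\<lambda>us. c * \<psi> us) vs = c * mukai \<phi> \<psi> vs"
  by (simp add: mukai_def wedge_mult_right)

text \<open>As \<open>u\<close> is real, its action commutes with conjugation. Moving the left
  \<open>u\<close> across the pairing lets it meet the right one, where the Clifford square is a
  scalar.\<close>

lemma mukai_spin_act_cnj:
  assumes \<phi>: "alt_form \<phi>"
  shows "mukai (spin_act u \<phi>) (\<lambda>us. cnj (spin_act u \<phi> us)) vs =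
    of_real (pairing u u) * mukai \<phi> (\<lambda>us. cnj (\<phi> us)) vs"
proof -
  let ?\<psi> = "\<lambda>us. cnj (\<phi> us)"
  have "mukai (spin_act u \<phi>) (\<lambda>us. cnj (spin_act u \<phi> us)) vs = mukai \<phi> (spin_act u (spin_act u ?\<psi>)) vs"
    using mukai_spin_act[OF \<phi> alt_form_spin_act[OF alt_form_cnj[OF \<phi>]]]
    by (simp add: cnj_spin_act)
  also have "spin_act u (spin_act u ?\<psi>) = (\<lambda>us. of_real (pairing u u) * ?\<psi> us)"
    using spin_act_square[OF alt_form_cnj[OF \<phi>]] by (simp add: fun_eq_iff)
  finally show ?thesis by (simp add: mukai_mult_right)
qed

lemma pairing_sym: "pairing u v = pairing v u"
  by (simp add: pairing_def add.commute)

lemma pairing_minus: "pairing (- u) v = - pairing u v" "pairing u (- v) = - pairing u v"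
  by (simp_all add: pairing_def blinfun.bilinear_simps field_simps)

lemma pairing_skew:
  assumes orth: "\<And>u v. pairing (J u) (J v) = pairing u v" and sq: "\<And>u. J (J u) = - u"
  shows "pairing (J u) v = - pairing u (J v)"
  using orth[of u "J v"] by (simp add: sq pairing_minus)

section \<open>Pure spinors\<close>

text \<open>The conjugate eigenspace consists exactly of the elements \<open>u + \<i> J u\<close>,
  so it can be parametrised by real \<open>u\<close>.\<close>

lemma canonical_fibre_iff:
  assumes lin: "linear J" and sq: "\<And>u. J (J u) = - u"
  shows "\<phi> \<in> canonical_fibre J \<longleftrightarrow> alt_form \<phi> \<and> (\<forall>u vs. cspin_act (u, J u) \<phi> vs = 0)"
proof -
  have "conj_eigenspace J = range (\<lambda>u. (u, J u))"
    unfolding conj_eigenspace_def i_eigenspace_def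
    using linear_neg[OF lin] sq by (auto simp: image_iff) (metis minus_minus)+
  then show ?thesis by (auto simp: canonical_fibre_def)
qed

text \<open>Allows annihilation to be checked on a spanning set of real \<open>u\<close>
  only.\<close>

lemma subspace_annihilator:
  assumes "alt_form \<phi>" and lin: "linear J"
  shows "subspace {u. \<forall>vs. cspin_act (u, J u) \<phi> vs = 0}"
proof -
  have "linear (\<lambda>u. cspin_act (u, J u) \<phi> vs)" for vs
  proof -
    have l: "linear (\<lambda>u. spin_act u \<phi> vs)" by (rule spin_act_linear_left[OF assms(1)])
    then have "linear (\<lambda>u. spin_act (J u) \<phi> vs)"
      using linear_compose[OF lin l] by (simp add: o_def)
    then show ?thesis
      unfolding cspin_act_def fst_conv snd_conv by (intro linear_compose_add l linear_cmult_real)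
  qed
  then have "subspace {u. cspin_act (u, J u) \<phi> vs = 0}" for vs
    by (rule linear_subspace_kernel)
  moreover have "{u. \<forall>vs. cspin_act (u, J u) \<phi> vs = 0} = (\<Inter>vs. {u. cspin_act (u, J u) \<phi> vs = 0})"
    by auto
  ultimately show ?thesis by (simp add: subspace_Inter)
qed

lemma finite_spanning_gtan:
  obtains B :: "'a::euclidean_space gtan set" where "finite B" "span B = UNIV"
proof
  let ?B = "(\<lambda>b. (b, 0)) ` Basis \<union> (\<lambda>b. (0, blinfun_inner_left b)) ` Basis :: 'a gtan set"
  show "finite ?B" by simp
  have "(x, \<xi>) \<in> span ?B" for x and \<xi> :: "'a \<Rightarrow>\<^sub>L real"
  proof -
    have "\<xi> = (\<Sum>b\<in>Basis. blinfun_apply \<xi> b *\<^sub>R blinfun_inner_left b)"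
      by (rule blinfun_euclidean_eqI)
         (simp add: blinfun.sum_left blinfun.scaleR_left inner_Basis if_distrib sum.delta cong: if_cong)
    then have "(x, \<xi>) = (\<Sum>b\<in>Basis. (x \<bullet> b) *\<^sub>R (b, 0)) +
        (\<Sum>b\<in>Basis. blinfun_apply \<xi> b *\<^sub>R (0, blinfun_inner_left b))"
      by (simp add: prod_eq_iff fst_sum snd_sum euclidean_representation)
    also have "\<dots> \<in> span ?B"
      by (intro span_add span_sum span_mul span_base) auto
    finally show ?thesis .
  qed
  then show "span ?B = UNIV" by auto
qed

text \<open>
  The operators \<open>w\<^sub>u = u + \<i> J u\<close> anticommute and square to zero. Starting from the constant 1 and
  applying those of a finite spanning family in turn, skipping every step that would give zero,
  one reaches a nonzero form killed by all of them.
\<close>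

lemma canonical_fibre_nonzero:
  fixes J :: "'a::euclidean_space gtan \<Rightarrow> 'a gtan"
  assumes lin: "linear J" and orth: "\<And>u v. pairing (J u) (J v) = pairing u v"
    and sq: "\<And>u. J (J u) = - u"
  obtains \<phi> vs where "\<phi> \<in> canonical_fibre J" "\<phi> vs \<noteq> 0"
proof -
  \<comment> \<open>The elements \<open>u + \<i> J u\<close> are mutually isotropic because
    \<open>J\<close> is both orthogonal and skew for the pairing.\<close>
  have anti: "cspin_act (u, J u) (cspin_act (v, J v) \<phi>) vs = - cspin_act (v, J v) (cspin_act (u, J u) \<phi>) vs"
    if "alt_form \<phi>" for u v \<phi> vs
    using that by (rule cspin_act_anticommute) (simp_all add: orth sq pairing_minus pairing_skew[of J, OF orth sq])
  have zero: "cspin_act w (\<lambda>_. 0) vs = 0" for w :: "'a cgtan" and vs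
    by (simp add: cspin_act_def spin_act_zero_right)
  have "\<exists>\<phi>. alt_form \<phi> \<and> (\<exists>vs. \<phi> vs \<noteq> 0) \<and> (\<forall>u\<in>B. \<forall>vs. cspin_act (u, J u) \<phi> vs = 0)"
    if "finite B" for B
    using that
  proof (induction B)
    case empty
    have "alt_form (\<lambda>vs :: 'a list. if vs = [] then 1 else 0 :: complex)"
      by (auto simp: alt_form_def linear_iff)
    then show ?case by (intro exI[of _ "\<lambda>vs. if vs = [] then 1 else 0"]) auto
  next
    case (insert u B)
    then obtain \<phi> where \<phi>: "alt_form \<phi>" "\<exists>vs. \<phi> vs \<noteq> 0"
        "\<And>v vs. v \<in> B \<Longrightarrow> cspin_act (v, J v) \<phi> vs = 0"
      by blast
    show ?case
    proof (cases "\<forall>vs. cspin_act (u, J u) \<phi> vs = 0")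
      case True
      with \<phi> show ?thesis by blast
    next
      case False
      have "cspin_act (u, J u) (cspin_act (u, J u) \<phi>) vs = 0" for vs
        using anti[OF \<phi>(1), of u u vs] by simp
      moreover have "cspin_act (v, J v) (cspin_act (u, J u) \<phi>) vs = 0" if "v \<in> B" for v vs
      proof -
        have "cspin_act (v, J v) \<phi> = (\<lambda>_. 0)" using \<phi>(3)[OF that] by blast
        then show ?thesis using anti[OF \<phi>(1), of v u vs] by (simp add: zero)
      qed
      ultimately show ?thesis
        using False alt_form_cspin_act[OF \<phi>(1)] by (intro exI[of _ "cspin_act (u, J u) \<phi>"]) auto
    qed
  qed
  moreover obtain B :: "'a gtan set" where B: "finite B" "span B = UNIV"
    by (rule finite_spanning_gtan)
  ultimately obtain \<phi> vs where \<phi>: "alt_form \<phi>" "\<phi> vs \<noteq> 0"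
      "\<forall>u\<in>B. \<forall>vs. cspin_act (u, J u) \<phi> vs = 0"
    by blast
  have "span B \<subseteq> {u. \<forall>vs. cspin_act (u, J u) \<phi> vs = 0}"
    using \<phi>(3) by (intro span_minimal subspace_annihilator \<phi>(1) lin) auto
  with B \<phi>(1) have "\<phi> \<in> canonical_fibre J"
    by (auto simp: canonical_fibre_iff[of J, OF lin sq])
  with \<phi>(2) show thesis using that by blast
qed

section \<open>Clifford multiplication by real vectors and its effect on annihilators\<close>

lemma spin_act_anticommute:
  assumes "alt_form \<phi>" "pairing u v = 0"
  shows "spin_act u (spin_act v \<phi>) vs = - spin_act v (spin_act u \<phi>) vs"
  using spin_act_clifford[OF assms(1), of u v vs] assms(2) by (simp add: eq_neg_iff_add_eq_0)

lemma cspin_act_spin_act: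
  assumes "alt_form \<phi>" "pairing u y = 0" "pairing v y = 0"
  shows "cspin_act (u, v) (spin_act y \<phi>) vs = - spin_act y (cspin_act (u, v) \<phi>) vs"
  using spin_act_anticommute[OF assms(1,2), of vs] spin_act_anticommute[OF assms(1,3), of vs]
  by (simp add: cspin_act_def[abs_def] spin_act_add_right spin_act_mult_right)

text \<open>\<open>y\<close> commutes with itself and anticommutes with \<open>v\<close>, so moving
  it past \<open>y + \<i> v\<close> changes the relative sign.\<close>

lemma cspin_act_spin_act_flip:
  assumes "alt_form \<phi>" "pairing v y = 0"
  shows "cspin_act (y, - v) (spin_act y \<phi>) vs = spin_act y (cspin_act (y, v) \<phi>) vs"
  using spin_act_anticommute[OF assms, of vs] linear_neg[OF spin_act_linear_left[OF alt_form_spin_act[OF assms(1)]], of v y vs]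
  by (simp add: cspin_act_def[abs_def] spin_act_add_right spin_act_mult_right)

text \<open>
  Multiplying by \<open>y\<close> replaces the annihilator \<open>y + \<i> J y\<close> by \<open>y - \<i> J y\<close> and keeps the
  annihilators orthogonal to \<open>y\<close> and \<open>J y\<close>.
\<close>

lemma foldr_spin_act_annihilated:
  assumes \<phi>: "alt_form \<phi>" "\<And>u vs. cspin_act (u, J u) \<phi> vs = 0"
    and orth: "\<And>u v. pairing (J u) (J v) = pairing u v" and sq: "\<And>u. J (J u) = - u"
    and ys: "sorted_wrt (\<lambda>y z. pairing y z = 0 \<and> pairing y (J z) = 0) ys"
  shows "alt_form (foldr spin_act ys \<phi>)" (is ?alt)
    and "\<And>u vs. (\<forall>y\<in>set ys. pairing u y = 0 \<and> pairing u (J y) = 0) \<Longrightarrow>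
      cspin_act (u, J u) (foldr spin_act ys \<phi>) vs = 0" (is "PROP ?perp")
    and "\<And>y vs. y \<in> set ys \<Longrightarrow> cspin_act (y, - J y) (foldr spin_act ys \<phi>) vs = 0" (is "PROP ?flip")
proof -
  note skew = pairing_skew[of J, OF orth sq]
  have self: "pairing (J y) y = 0" for y
    using skew[of y y] pairing_sym[of y "J y"] by simp
  have "?alt \<and>
    (\<forall>u. (\<forall>y\<in>set ys. pairing u y = 0 \<and> pairing u (J y) = 0) \<longrightarrow>
      cspin_act (u, J u) (foldr spin_act ys \<phi>) = (\<lambda>_. 0)) \<and>
    (\<forall>y\<in>set ys. cspin_act (y, - J y) (foldr spin_act ys \<phi>) = (\<lambda>_. 0))"
    using ys
  proof (induction ys)
    case Nil
    then show ?case using \<phi> by auto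
  next
    case (Cons y ys)
    define \<psi> where "\<psi> = foldr spin_act ys \<phi>"
    have y: "pairing y z = 0" "pairing y (J z) = 0" if "z \<in> set ys" for z
      using Cons.prems that by auto
    have IH: "alt_form \<psi> \<and>
      (\<forall>u. (\<forall>z\<in>set ys. pairing u z = 0 \<and> pairing u (J z) = 0) \<longrightarrow>
        cspin_act (u, J u) \<psi> = (\<lambda>_. 0)) \<and>
      (\<forall>z\<in>set ys. cspin_act (z, - J z) \<psi> = (\<lambda>_. 0))"
      unfolding \<psi>_def using Cons.prems by (intro Cons.IH) simp
    have alt: "alt_form \<psi>"
      and perp: "\<And>u. (\<And>z. z \<in> set ys \<Longrightarrow> pairing u z = 0 \<and> pairing u (J z) = 0) \<Longrightarrow>
          cspin_act (u, J u) \<psi> = (\<lambda>_. 0)"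
      and flip: "\<And>z. z \<in> set ys \<Longrightarrow> cspin_act (z, - J z) \<psi> = (\<lambda>_. 0)"
      using IH by blast+
    \<comment> \<open>By skewness \<open>u\<close> orthogonal to \<open>J y\<close> means
      \<open>J u\<close> orthogonal to \<open>y\<close>, so \<open>y\<close> anticommutes with both
      \<open>u\<close> and \<open>J u\<close>.\<close>
    have "cspin_act (u, J u) (spin_act y \<psi>) vs = 0"
      if "\<forall>z\<in>set (y # ys). pairing u z = 0 \<and> pairing u (J z) = 0" for u vs
      using that perp[of u] cspin_act_spin_act[OF alt, of u y "J u" vs]
      by (simp add: skew spin_act_zero_right)
    \<comment> \<open>\<open>foldr\<close> applies the head \<open>y\<close> last. It is orthogonal
      to all \<open>z\<close> and \<open>J z\<close> in the tail, so \<open>y + \<i> J y\<close>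
      still annihilates \<psi> and is now flipped.\<close>
    moreover have "cspin_act (y, - J y) (spin_act y \<psi>) vs = 0" for vs
      using perp[of y] y cspin_act_spin_act_flip[OF alt self, of y vs]
      by (simp add: spin_act_zero_right)
    moreover have "cspin_act (z, - J z) (spin_act y \<psi>) vs = 0" if "z \<in> set ys" for z vs
      using cspin_act_spin_act[OF alt, of z y "- J z" vs] flip[OF that] y[OF that]
      by (simp add: pairing_sym[of _ y] pairing_minus spin_act_zero_right)
    ultimately show ?case
      using alt_form_spin_act[OF alt] by (auto simp flip: \<psi>_def)
  qed
  then show ?alt "PROP ?perp" "PROP ?flip" by auto
qed

text \<open>Acting twice by \<open>y\<close> multiplies by the nonzero scalar
  \<open>pairing y y\<close>. Hence no factor kills a nonzero form, and each one rescales the length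
  by that scalar.\<close>

lemma foldr_spin_act_nonzero:
  assumes \<phi>: "alt_form \<phi>" "\<exists>vs. \<phi> vs \<noteq> 0" and ys: "\<And>y. y \<in> set ys \<Longrightarrow> pairing y y \<noteq> 0"
  shows "\<exists>vs. foldr spin_act ys \<phi> vs \<noteq> 0"
    and "\<exists>c\<noteq>0. \<forall>vs. mukai (foldr spin_act ys \<phi>) (\<lambda>us. cnj (foldr spin_act ys \<phi> us)) vs =
      c * mukai \<phi> (\<lambda>us. cnj (\<phi> us)) vs"
proof -
  have alt: "alt_form (foldr spin_act ys \<phi>)" for ys
    by (induction ys) (simp_all add: \<phi> alt_form_spin_act)
  show "\<exists>vs. foldr spin_act ys \<phi> vs \<noteq> 0"
    using ys
  proof (induction ys)
    case (Cons y ys)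
    then obtain vs where "foldr spin_act ys \<phi> vs \<noteq> 0" by auto
    then have "spin_act y (spin_act y (foldr spin_act ys \<phi>)) vs \<noteq> 0"
      using Cons.prems by (simp add: spin_act_square[OF alt])
    then have "spin_act y (foldr spin_act ys \<phi>) \<noteq> (\<lambda>_. 0)"
      by (auto simp: spin_act_zero_right)
    then show ?case by (auto simp: fun_eq_iff)
  qed (use \<phi> in simp)
  show "\<exists>c\<noteq>0. \<forall>vs. mukai (foldr spin_act ys \<phi>) (\<lambda>us. cnj (foldr spin_act ys \<phi> us)) vs =
      c * mukai \<phi> (\<lambda>us. cnj (\<phi> us)) vs"
    using ys
  proof (induction ys)
    case Nil
    show ?case by (intro exI[of _ 1]) simp
  next
    case (Cons y ys)
    then obtain c where "c \<noteq> 0" "\<And>vs. mukai (foldr spin_act ys \<phi>) (\<lambda>us. cnj (foldr spin_act ys \<phi> us)) vs =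
        c * mukai \<phi> (\<lambda>us. cnj (\<phi> us)) vs"
      by auto
    then show ?case
      using Cons.prems by (intro exI[of _ "of_real (pairing y y) * c"])
        (simp add: mukai_spin_act_cnj[OF alt])
  qed
qed

section \<open>Invariant generalized Kaehler structures\<close>

text \<open>Among all such lists, one whose vectors and images span a space of maximal dimension is
  taken. A new vector is prepended, so it only has to be orthogonal to the vectors already listed
  and to their images.\<close>

lemma orthogonal_spanning_list:
  fixes g :: "'a::euclidean_space \<Rightarrow> 'a \<Rightarrow>\<^sub>L real"
  assumes g: "inner_product g"
  obtains xs where "0 \<notin> set xs" "sorted_wrt (\<lambda>x y. blinfun_apply (g x) y = 0 \<and> blinfun_apply (g x) (I y) = 0) xs"
    "span (set xs \<union> I ` set xs) = UNIV"
proof -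
  define P where "P xs \<longleftrightarrow> 0 \<notin> set xs \<and>
    sorted_wrt (\<lambda>x y. blinfun_apply (g x) y = 0 \<and> blinfun_apply (g x) (I y) = 0) xs" for xs
  define d where "d xs = dim (set xs \<union> I ` set xs)" for xs
  have "P []" "\<forall>xs. P xs \<longrightarrow> d xs < Suc DIM('a)"
    by (simp_all add: P_def d_def dim_subset_UNIV less_Suc_eq_le)
  then have "\<exists>xs. P xs \<and> (\<forall>ys. P ys \<longrightarrow> d ys \<le> d xs)"
    by (rule ex_has_greatest_nat)
  then obtain xs where xs: "P xs" and max: "\<And>ys. P ys \<Longrightarrow> d ys \<le> d xs"
    by blast
  define S where "S = set xs \<union> I ` set xs"
  have "span S = UNIV"
  proof (rule ccontr)
    assume "span S \<noteq> UNIV"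
    then obtain a where a: "a \<noteq> 0" "\<forall>s\<in>span S. a \<bullet> s = 0"
      using span_not_UNIV_orthogonal by blast
    \<comment> \<open>Surjectivity of \<open>g\<close> converts the Euclidean normal
      \<open>a\<close> into a vector that is \<open>g\<close>-orthogonal to
      \<open>span S\<close>.\<close>
    obtain x where x: "g x = blinfun_inner_left a"
      using inner_product_surj[OF g] by (metis bij_def surjD)
    have gx: "blinfun_apply (g x) s = 0" if "s \<in> span S" for s
      using a that by (simp add: x inner_commute[of s a])
    have "x \<noteq> 0"
    proof
      assume "x = 0"
      then have "g x = 0" using g by (simp add: inner_product_def linear_0)
      then have "blinfun_apply (blinfun_inner_left a) a = 0" by (simp flip: x)
      with a show False by simp
    qed
    then have nx: "x \<notin> span S"
      using g gx[of x] by (auto simp: inner_product_def)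
    have "P (x # xs)"
      using xs \<open>x \<noteq> 0\<close> by (auto simp: P_def S_def intro!: gx span_base)
    moreover have "d (x # xs) \<ge> dim (insert x S)"
      unfolding d_def S_def by (rule dim_subset) auto
    ultimately show False
      using max[of "x # xs"] nx by (simp add: dim_insert d_def S_def)
  qed
  then show thesis using that xs by (auto simp: P_def S_def)
qed

text \<open>
  For \<open>s = \<plusminus>1\<close>, the vectors \<open>(x, s g x)\<close> form the \<open>s\<close>-eigenspace of \<open>- J K\<close>, which \<open>J\<close> preserves.
\<close>

lemma kahler_eigen:
  fixes g :: "'a::euclidean_space \<Rightarrow> 'a \<Rightarrow>\<^sub>L real" and J K :: "'a gtan \<Rightarrow> 'a gtan"
  assumes g: "inner_product g"
    and J: "linear J" "\<And>u v. pairing (J u) (J v) = pairing u v" "\<And>u. J (J u) = - u"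
    and JK: "\<And>u. J (K u) = K (J u)" "\<And>u. - J (K u) = (inv g (snd u), g (fst u))"
    and s: "s * s = 1"
  shows "K (x, s *\<^sub>R g x) = s *\<^sub>R J (x, s *\<^sub>R g x)"
    and "\<exists>I. orthogonal_complex_structure g I \<and> (\<forall>x. J (x, s *\<^sub>R g x) = (I x, s *\<^sub>R g (I x)))"
proof -
  have lin: "linear g" and gsym: "\<And>x y. blinfun_apply (g x) y = blinfun_apply (g y) x"
    using g by (auto simp: inner_product_def)
  note Js = linear_neg[OF J(1)] linear_cmul[OF J(1)] linear_add[OF J(1)]
  have inv: "inv g (g x) = x" for x
    using inner_product_surj[OF g] by (simp add: bij_def)
  define c where "c x = (x, s *\<^sub>R g x)" for x
  have K: "K (c x) = s *\<^sub>R J (c x)" for x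
  proof -
    have "inv g (s *\<^sub>R g x) = s *\<^sub>R x" using inv[of "s *\<^sub>R x"] by (simp add: linear_cmul[OF lin])
    then have "- J (K (c x)) = s *\<^sub>R c x" by (simp add: JK(2) c_def s)
    then have "J (- J (K (c x))) = s *\<^sub>R J (c x)" by (simp add: Js)
    then show ?thesis by (simp add: Js J(3))
  qed
  then show "K (x, s *\<^sub>R g x) = s *\<^sub>R J (x, s *\<^sub>R g x)"
    by (simp add: c_def)
  define I where "I x = fst (J (c x))" for x
  \<comment> \<open>\<open>J\<close> commutes with \<open>- J K\<close>, so \<open>J (c x)\<close>
    is again in the \<open>s\<close>-eigenspace and is determined by its vector part.\<close>
  have Jc: "J (c x) = c (I x)" for x
  proof -
    have "- J (K (J (c x))) = s *\<^sub>R J (c x)"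
      by (simp add: JK(1)[symmetric] J(3) K Js)
    then have "g (fst (J (c x))) = s *\<^sub>R snd (J (c x))"
      by (simp add: JK(2)) (metis snd_conv snd_scaleR)
    then have "snd (J (c x)) = s *\<^sub>R g (I x)"
      by (simp add: I_def s)
    then show ?thesis by (simp add: c_def I_def prod_eq_iff)
  qed
  have c: "c (x + y) = c x + c y" "c (r *\<^sub>R x) = r *\<^sub>R c x" "c (- x) = - c x" for x y r
    by (simp_all add: c_def linear_add[OF lin] linear_cmul[OF lin] linear_neg[OF lin] algebra_simps)
  have "linear I"
    by (rule linearI) (simp_all add: I_def c Js)
  moreover have "I (I x) = - x" for x
  proof -
    have "c (I (I x)) = c (- x)" by (simp add: Jc[symmetric] J(3) c)
    then show ?thesis by (simp add: c_def)
  qed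
  \<comment> \<open>On the eigenspace the pairing is \<open>s\<close> times \<open>g\<close>, so
    orthogonality of \<open>J\<close> descends to \<open>I\<close> after cancelling
    \<open>s\<close>, which is nonzero.\<close>
  moreover have "pairing (c x) (c y) = s * blinfun_apply (g x) y" for x y
    using gsym[of x y] by (simp add: pairing_def c_def blinfun.scaleR_left)
  then have "s * blinfun_apply (g (I x)) (I y) = s * blinfun_apply (g x) y" for x y
    using J(2)[of "c x" "c y"] by (simp add: Jc)
  then have "blinfun_apply (g (I x)) (I y) = blinfun_apply (g x) y" for x y
    using s by (metis mult_cancel_left mult_zero_left zero_neq_one)
  ultimately show "\<exists>I. orthogonal_complex_structure g I \<and> (\<forall>x. J (x, s *\<^sub>R g x) = (I x, s *\<^sub>R g (I x)))"
    using Jc unfolding orthogonal_complex_structure_def c_def by blast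
qed

section \<open>Vanishing of the invariant 3-form\<close>

text \<open>By antisymmetry \<open>I\<close> may be inserted into any two slots. Inserting it into
  slots 2 and 3, then 1 and 3, and removing it from 1 and 2 leaves \<open>I (I z) = - z\<close> in
  the third slot, so \<open>f\<close> equals its own negative.\<close>

lemma three_form_eq_0:
  fixes f :: "'a::real_vector list \<Rightarrow> real"
  assumes alt: "alt_form f" and sq: "\<And>x. I (I x) = - x"
    and inv: "\<And>x y z. f [I x, I y, z] = f [x, y, z]"
  shows "f [x, y, z] = 0"
proof -
  have s12: "f [a, b, c] = - f [b, a, c]" and s23: "f [a, b, c] = - f [a, c, b]" for a b c
    using alt_form_swap[OF alt, of "[]" a b "[c]"] alt_form_swap[OF alt, of "[a]" b c "[]"] by simp_all
  have i23: "f [a, I b, I c] = f [a, b, c]" for a b c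
  proof -
    have "f [a, I b, I c] = f [I b, I c, a]" using s12[of a "I b" "I c"] s23[of "I b" a "I c"] by simp
    also have "\<dots> = f [b, c, a]" by (rule inv)
    also have "\<dots> = f [a, b, c]" using s12[of a b c] s23[of b a c] by simp
    finally show ?thesis .
  qed
  have i13: "f [I a, b, I c] = f [a, b, c]" for a b c
    using s23[of "I a" b "I c"] s23[of a b c] inv[of a c b] by simp
  have "f [x, y, z] = f [x, I y, I z]" by (simp add: i23)
  also have "\<dots> = f [I x, I y, I (I z)]" by (simp only: i13)
  also have "\<dots> = f [x, y, - z]" by (simp add: inv sq)
  also have "\<dots> = - f [x, y, z]"
    using linear_neg[OF alt_form_linear[OF alt, of "[x, y]" "[]"], of z] by simp
  finally show ?thesis by simp
qed

lemma dorfman_const: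
  "dorfman \<gamma> (\<lambda>_. u) (\<lambda>_. v) p = (0, Blinfun (\<lambda>z. \<gamma> p [fst v, fst u, z]))"
  by (simp add: dorfman_def Let_def lie_bracket_def inv_deriv_def lie_deriv_def ext_deriv_def)

lemma invariant_three_form_eq_0:
  fixes g :: "'a::euclidean_space \<Rightarrow> 'a \<Rightarrow>\<^sub>L real" and J K :: "'a gtan \<Rightarrow> 'a gtan"
  assumes p: "p \<in> torus \<Lambda>"
    and gcJ: "generalized_complex \<Lambda> \<gamma> Jp" and gcK: "generalized_complex \<Lambda> \<gamma> Jm"
    and Jp: "\<And>q. q \<in> torus \<Lambda> \<Longrightarrow> Jp q = J" and Jm: "\<And>q. q \<in> torus \<Lambda> \<Longrightarrow> Jm q = K"
    and g: "inner_product g"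
    and JK: "\<And>u. J (K u) = K (J u)" "\<And>u. - J (K u) = (inv g (snd u), g (fst u))"
    and \<gamma>: "closed_three_form \<Lambda> \<gamma>"
  shows "\<gamma> p vs = 0"
proof -
  have J: "linear J" "\<And>u v. pairing (J u) (J v) = pairing u v" "\<And>u. J (J u) = - u"
    using gcJ p Jp unfolding generalized_complex_def by metis+
  have K: "linear K"
    using gcK p Jm unfolding generalized_complex_def by metis
  have alt: "alt_form (\<gamma> p)" and deg: "\<And>vs. length vs \<noteq> 3 \<Longrightarrow> \<gamma> p vs = 0"
    using \<gamma> p unfolding closed_three_form_def smooth_form_def by blast+
  obtain I where I: "orthogonal_complex_structure g I" "\<And>x. J (x, g x) = (I x, g (I x))"
    using kahler_eigen(2)[OF g J JK, of 1] by auto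
  have KJ: "K (x, g x) = J (x, g x)" for x
    using kahler_eigen(1)[OF g J JK, of 1 x] by simp
  have KJ': "K (J (x, g x)) = - (x, g x)" for x
    by (simp add: JK(1)[symmetric] KJ J(3))
  define B where "B x y = Blinfun (\<lambda>z. \<gamma> p [x, y, z])" for x y
  have B: "blinfun_apply (B x y) z = \<gamma> p [x, y, z]" for x y z
  proof -
    have "linear (\<lambda>z. \<gamma> p [x, y, z])" using alt_form_linear[OF alt, of "[x, y]" "[]"] by simp
    then show ?thesis
      unfolding B_def by (simp add: bounded_linear_Blinfun_apply linear_conv_bounded_linear)
  qed
  have "\<gamma> p [I x, I y, z] = \<gamma> p [x, y, z]" for x y z
  proof -
    \<comment> \<open>constant sections of \<open>L\<^sub>+ \<inter> L\<^sub>-\<close>; their bracket is a 1-form lying in both eigenbundles, hence 0\<close>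
    define s where "s w = ((w, g w), - J (w, g w))" for w
    have sJ: "s w \<in> i_eigenspace J" and sK: "s w \<in> i_eigenspace K" for w
      by (simp_all add: s_def i_eigenspace_def linear_neg[OF J(1)] linear_neg[OF K] J(3) KJ KJ')
    \<comment> \<open>The sections come in the order \<open>y\<close>, \<open>x\<close> because the
      \<gamma> term of the bracket interchanges its arguments.\<close>
    define \<delta> where "\<delta> = cdorfman \<gamma> (\<lambda>_. s y) (\<lambda>_. s x) p"
    have "\<delta> \<in> i_eigenspace J"
      unfolding \<delta>_def using gcJ p sJ Jp smooth_on_torus_const[of \<Lambda> "\<lambda>_. s _"]
      unfolding generalized_complex_def by (metis (no_types, lifting))
    moreover have "\<delta> \<in> i_eigenspace K"
      unfolding \<delta>_def using gcK p sK Jm smooth_on_torus_const[of \<Lambda> "\<lambda>_. s _"]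
      unfolding generalized_complex_def by (metis (no_types, lifting))
    ultimately have "J (fst \<delta>) = K (fst \<delta>)"
      by (auto simp: i_eigenspace_def)
    \<comment> \<open>The real part of the bracket is fixed by \<open>- J K\<close>, so it lies on
      the graph of \<open>g\<close>. Its vector part is 0, hence so is its covector part.\<close>
    then have "fst \<delta> = (inv g (snd (fst \<delta>)), g (fst (fst \<delta>)))"
      using J(3)[of "fst \<delta>"] JK(2)[of "fst \<delta>"] by simp
    moreover have fst\<delta>: "fst \<delta> = (0, B x y - B (- I x) (- I y))"
      by (simp add: \<delta>_def cdorfman_def Let_def dorfman_const s_def I(2) B_def)
    ultimately have "B x y - B (- I x) (- I y) = g 0"
      by simp
    then have "B x y = B (- I x) (- I y)"
      using g by (simp add: inner_product_def linear_0)
    then have "\<gamma> p [x, y, z] = \<gamma> p [- I x, - I y, z]"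
      by (simp flip: B)
    also have "\<dots> = \<gamma> p [I x, I y, z]"
      using linear_neg[OF alt_form_linear[OF alt, of "[]" "[- I y, z]"], of "I x"]
        linear_neg[OF alt_form_linear[OF alt, of "[I x]" "[z]"], of "I y"] by simp
    finally show ?thesis by simp
  qed
  then have "\<gamma> p [x, y, z] = 0" for x y z
    using three_form_eq_0[OF alt] I(1) by (metis orthogonal_complex_structure_def)
  then show ?thesis
    using deg[of vs] by (cases "length vs = 3") (auto simp: numeral_3_eq_3 length_Suc_conv)
qed

section \<open>From pure spinors of one structure to pure spinors of the other\<close>

text \<open>\<open>K\<close> agrees with \<open>J\<close> on the graph of \<open>g\<close> and with
  \<open>- J\<close> on the graph of \<open>- g\<close>. The annihilators over the first graph must
  be kept and those over the second conjugated; the graphs being orthogonal, a product of vectors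
  \<open>cm x\<close> does both.\<close>

lemma canonical_fibre_exchange:
  fixes g :: "'a::euclidean_space \<Rightarrow> 'a \<Rightarrow>\<^sub>L real" and J K :: "'a gtan \<Rightarrow> 'a gtan"
  assumes g: "inner_product g"
    and J: "linear J" "\<And>u v. pairing (J u) (J v) = pairing u v" "\<And>u. J (J u) = - u"
    and K: "linear K" "\<And>u. K (K u) = - u"
    and JK: "\<And>u. J (K u) = K (J u)" "\<And>u. - J (K u) = (inv g (snd u), g (fst u))"
    and \<phi>: "\<phi> \<in> canonical_fibre J" "\<exists>vs. \<phi> vs \<noteq> 0"
  obtains \<psi> c where "\<psi> \<in> canonical_fibre K" "\<exists>vs. \<psi> vs \<noteq> 0" "c \<noteq> 0"
    "\<forall>vs. mukai \<psi> (\<lambda>us. cnj (\<psi> us)) vs = c * mukai \<phi> (\<lambda>us. cnj (\<phi> us)) vs"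
proof -
  have alt: "alt_form \<phi>" and ann: "\<And>u vs. cspin_act (u, J u) \<phi> vs = 0"
    using \<phi>(1) by (auto simp: canonical_fibre_iff[of J, OF J(1,3)])
  have lin: "linear g" and gsym: "\<And>x y. blinfun_apply (g x) y = blinfun_apply (g y) x"
    and pos: "\<And>x. x \<noteq> 0 \<Longrightarrow> blinfun_apply (g x) x > 0"
    using g by (auto simp: inner_product_def)
  define cp where "cp x = (x, g x)" for x
  define cm where "cm x = (x, - g x)" for x
  have KJp: "K (cp x) = J (cp x)" and KJm: "K (cm x) = - J (cm x)" for x
    using kahler_eigen(1)[OF g J JK, of 1 x] kahler_eigen(1)[OF g J JK, of "-1" x]
    by (simp_all add: cp_def cm_def)
  obtain I where I: "orthogonal_complex_structure g I" "\<And>x. J (cm x) = cm (I x)"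
    using kahler_eigen(2)[OF g J JK, of "-1"] by (auto simp: cm_def)
  obtain xs where xs: "0 \<notin> set xs"
      "sorted_wrt (\<lambda>x y. blinfun_apply (g x) y = 0 \<and> blinfun_apply (g x) (I y) = 0) xs"
      "span (set xs \<union> I ` set xs) = UNIV"
    by (rule orthogonal_spanning_list[OF g])
  define ys where "ys = map cm xs"
  define \<psi> where "\<psi> = foldr spin_act ys \<phi>"
  have pmm: "pairing (cm x) (cm y) = - blinfun_apply (g x) y" for x y
    using gsym[of x y] by (simp add: pairing_def cm_def blinfun.bilinear_simps)
  have ppm: "pairing (cp x) (cm y) = 0" for x y
    using gsym[of x y] by (simp add: pairing_def cp_def cm_def blinfun.bilinear_simps)
  have sorted: "sorted_wrt (\<lambda>y z. pairing y z = 0 \<and> pairing y (J z) = 0) ys"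
    using xs(2) by (simp add: ys_def sorted_wrt_map I(2) pmm)
  note \<psi> = foldr_spin_act_annihilated[of \<phi> J, OF alt ann J(2,3) sorted, folded \<psi>_def]
  have nz: "pairing y y \<noteq> 0" if "y \<in> set ys" for y
  proof -
    from that obtain x where y: "y = cm x" and x: "x \<in> set xs" by (auto simp: ys_def)
    with xs(1) have "x \<noteq> 0" by auto
    from pos[OF this] show ?thesis by (simp add: y pmm)
  qed
  define N where "N = {u. \<forall>vs. cspin_act (u, K u) \<psi> vs = 0}"
  have subN: "subspace N"
    unfolding N_def by (rule subspace_annihilator[OF \<psi>(1) K(1)])
  \<comment> \<open>The element over \<open>K u\<close> is \<open>- \<i>\<close> times the element
    over \<open>u\<close>. So the vectors \<open>cm (I x)\<close> will follow from the vectors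
    \<open>cm x\<close>.\<close>
  have N_K: "K u \<in> N" if "u \<in> N" for u
  proof -
    have "cspin_act (K u, K (K u)) \<psi> vs = - \<i> * cspin_act (u, K u) \<psi> vs" for vs
      using linear_neg[OF spin_act_linear_left[OF \<psi>(1)], of u vs]
      by (simp add: cspin_act_def K(2) algebra_simps)
    with that show ?thesis by (simp add: N_def)
  qed
  have Np: "cp x \<in> N" for x
    using \<psi>(2)[of "cp x"] by (simp add: N_def KJp ys_def I(2) ppm)
  \<comment> \<open>Each factor has flipped its own annihilator to \<open>y - \<i> J y\<close>,
    which is \<open>y + \<i> K y\<close> on this graph.\<close>
  have Nx: "cm x \<in> N" if "x \<in> set xs" for x
    using \<psi>(3)[of "cm x"] that by (simp add: N_def KJm ys_def)
  have NIx: "cm (I x) \<in> N" if "x \<in> set xs" for x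
    using N_K[OF Nx[OF that]] subspace_neg[OF subN, of "K (cm x)"] by (simp add: KJm I(2))
  have "linear cm"
    by (rule linearI) (simp_all add: cm_def linear_add[OF lin] linear_cmul[OF lin])
  then have "subspace (cm -` N)"
    using subN by (rule linear_subspace_vimage)
  then have "span (set xs \<union> I ` set xs) \<subseteq> cm -` N"
    by (intro span_minimal) (auto simp: Nx NIx)
  then have Nm: "cm x \<in> N" for x
    using xs(3) by auto
  have "u \<in> N" for u
  proof -
    obtain a' a where "u = (a' - a, g (a' + a))" by (rule gtan_decomposition[OF g])
    then have "u = cp a' - cm a" by (simp add: cp_def cm_def linear_add[OF lin])
    then show ?thesis using subspace_diff[OF subN Np Nm] by simp
  qed
  then have "\<psi> \<in> canonical_fibre K"
    using \<psi>(1) by (simp add: canonical_fibre_iff[of K, OF K] N_def)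
  then show thesis
    using that foldr_spin_act_nonzero[OF alt \<phi>(2) nz] unfolding \<psi>_def by metis
qed

lemma calabi_yau_section_const:
  fixes \<rho>0 :: "'a::euclidean_space list \<Rightarrow> complex"
  assumes \<gamma>: "\<And>p vs. p \<in> torus \<Lambda> \<Longrightarrow> \<gamma> p vs = 0"
    and J: "\<And>p. p \<in> torus \<Lambda> \<Longrightarrow> J p = J0"
    and \<rho>: "\<rho>0 \<in> canonical_fibre J0" "\<exists>vs. \<rho>0 vs \<noteq> 0"
  shows "calabi_yau_section \<Lambda> \<gamma> J (\<lambda>_. \<rho>0)"
proof -
  have "alt_form \<rho>0" using \<rho>(1) by (simp add: canonical_fibre_def)
  then have "smooth_form \<Lambda> (\<lambda>_. \<rho>0)"
    by (simp add: smooth_form_def smooth_on_torus_const)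
  moreover have "twisted_deriv \<gamma> (\<lambda>_. \<rho>0) p vs = 0" if "p \<in> torus \<Lambda>" for p vs
    using \<gamma>[OF that] by (simp add: twisted_deriv_def ext_deriv_def inv_deriv_def wedge_zero_left)
  ultimately show ?thesis
    using J \<rho> by (simp add: calabi_yau_section_def)
qed

text \<open>The torus is a single orbit of the translations.\<close>

lemma translation_invariant_const:
  assumes "translation_invariant \<Lambda> F" "p \<in> torus \<Lambda>"
  shows "F p = F (torus_exp \<Lambda> 0)"
proof -
  obtain x where "p = translate x (torus_exp \<Lambda> 0)"
    using assms(2) by (auto simp: torus_def translate_torus_exp)
  moreover have "torus_exp \<Lambda> 0 \<in> torus \<Lambda>" by (simp add: torus_def)
  ultimately show ?thesis using assms(1) by (simp add: translation_invariant_def)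
qed

theorem corollary5p23:
  fixes \<Lambda> :: "'a::euclidean_space set"
    and \<gamma> :: "'a set \<Rightarrow> 'a list \<Rightarrow> real"
    and Jp Jm :: "'a set \<Rightarrow> 'a gtan \<Rightarrow> 'a gtan"
    and g :: "'a set \<Rightarrow> 'a \<Rightarrow> 'a \<Rightarrow>\<^sub>L real"
  assumes "full_lattice \<Lambda>"
    and "even DIM('a)"
    and "invariant_generalized_kahler \<Lambda> \<gamma> Jp Jm g"
  shows "generalized_calabi_yau_metric \<Lambda> \<gamma> Jp Jm g"
proof -
  \<comment> \<open>At the identity \<open>e\<close> everything reduces to linear algebra;
    invariance carries \<open>Jp\<close> and \<open>Jm\<close> to all other points.\<close>
  define e where "e = torus_exp \<Lambda> 0"
  have e: "e \<in> torus \<Lambda>" by (simp add: e_def torus_def)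
  have kahler: "generalized_kahler \<Lambda> \<gamma> Jp Jm g"
    and inv: "translation_invariant \<Lambda> Jp" "translation_invariant \<Lambda> Jm"
    using assms(3) by (simp_all add: invariant_generalized_kahler_def)
  have Jp: "Jp p = Jp e" and Jm: "Jm p = Jm e" if "p \<in> torus \<Lambda>" for p
    using inv that unfolding e_def by (blast intro: translation_invariant_const)+
  have gc: "generalized_complex \<Lambda> \<gamma> Jp" "generalized_complex \<Lambda> \<gamma> Jm"
    and \<gamma>: "closed_three_form \<Lambda> \<gamma>" and g: "inner_product (g e)"
    and JK: "\<And>u. Jp e (Jm e u) = Jm e (Jp e u)"
      "\<And>u. - Jp e (Jm e u) = (inv (g e) (snd u), g e (fst u))"
    using kahler e unfolding generalized_kahler_def riemannian_metric_def by blast+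
  have J: "linear (Jp e)" "\<And>u v. pairing (Jp e u) (Jp e v) = pairing u v"
      "\<And>u. Jp e (Jp e u) = - u"
    and K: "linear (Jm e)" "\<And>u. Jm e (Jm e u) = - u"
    using gc e unfolding generalized_complex_def by blast+
  have \<gamma>0: "\<gamma> p vs = 0" if "p \<in> torus \<Lambda>" for p vs
    by (rule invariant_three_form_eq_0[OF that gc Jp Jm g JK \<gamma>])
  obtain \<phi> where \<phi>: "\<phi> \<in> canonical_fibre (Jp e)" "\<exists>vs. \<phi> vs \<noteq> 0"
    using canonical_fibre_nonzero[of "Jp e", OF J] by blast
  obtain \<psi> c where \<psi>: "\<psi> \<in> canonical_fibre (Jm e)" "\<exists>vs. \<psi> vs \<noteq> 0" and c: "c \<noteq> 0"
      "\<forall>vs. mukai \<psi> (\<lambda>us. cnj (\<psi> us)) vs = c * mukai \<phi> (\<lambda>us. cnj (\<phi> us)) vs"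
    by (rule canonical_fibre_exchange[OF g J K JK \<phi>])
  have sp: "calabi_yau_section \<Lambda> \<gamma> Jp (\<lambda>_. \<phi>)"
    by (rule calabi_yau_section_const[OF \<gamma>0 Jp \<phi>])
  have sm: "calabi_yau_section \<Lambda> \<gamma> Jm (\<lambda>_. \<psi>)"
    by (rule calabi_yau_section_const[OF \<gamma>0 Jm \<psi>])
  \<comment> \<open>The exchange expresses the length of \<psi> by that of \<phi>, whereas the
    definition asks for the opposite direction, hence the inverse constant.\<close>
  have "mukai \<phi> (\<lambda>us. cnj (\<phi> us)) vs = inverse c * mukai \<psi> (\<lambda>us. cnj (\<psi> us)) vs" for vs
    using c by simp
  moreover have "inverse c \<noteq> 0" using c(1) by simp
  ultimately show ?thesis
    using kahler gc sp sm
    unfolding generalized_calabi_yau_metric_def generalized_calabi_yau_def by blast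
qed

end
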